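(* Let $G=\mathrm{SL}_n(F)$, let $K=\mathrm{SO}_n(F)=\{g\in \mathrm{SL}_n(F): g^Tg=1_n\}$, and let $B\subset G$ be the Iwahori subgroup of $\mathrm{SL}_n(F)$. For each double coset $\mathcal{O}\in K\backslash G/B$ there exists a unique $w\in i\mathsf{SymAPM}_n$ such that $g^Tg=w$ for some $g\in\mathcal{O}$. Moreover, for each $w\in i\mathsf{SymAPM}_n$, the set of matrices $g\in G$ satisfying $g^Tg=w$ is non-empty and its elements all lie in the same double coset in $K\backslash G/B$.
   Context: $n$ is a positive integer. $\mathbb{K}$ is a quadratically closed field, i.e. a field of characteristic not equal to $2$ in which every element has a square root; fix $i=\sqrt{-1}\in\mathbb{K}$. $F=\mathbb{K}((t))$ is the field of formal Laurent series and $A=\mathbb{K}[[t]]$ the ring of formal power series. $1_n$ is the $n\times n$ identity matrix. The Iwahori subgroup $B$ is the subgroup of $\mathrm{SL}_n(A)$ consisting of the matrices that become upper triangular upon setting $t=0$. A monomial matrix is a square matrix with exactly one non-zero entry in each row and column. $i\mathsf{SymAPM}_n\subset \mathrm{SL}_n(F)$ is the set of symmetric $n\times n$ monomial matrices of determinant $1$ such that: (i) if there are any non-zero entries on the diagonal, then the non-zero diagonal entries are of the form $t^a$ and the non-zero off-diagonal entries are of the form $i\,t^a$, with $a\in\mathbb{Z}$ (the exponent may vary from entry to entry); (ii) if there are no non-zero entries on the diagonal, then the non-zero entries in the first row and first column are of the form $\pm i\,t^a$, while the remaining non-zero entries are of the form $i\,t^a$, with $a\in\mathbb{Z}$ (the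 exponent may vary from entry to entry). *)

theory Defs
  imports
    "HOL-Computational_Algebra.Formal_Laurent_Series"
    "HOL-Algebra.Coset"
    "Jordan_Normal_Form.Determinant"
begin

definition SL :: "nat \<Rightarrow> 'r::comm_ring_1 mat monoid" where
  "SL n = \<lparr>carrier = {M \<in> carrier_mat n n. det M = 1},
           monoid.mult = (\<lambda>M N. M * N), one = 1\<^sub>m n\<rparr>"

definition SO :: "nat \<Rightarrow> 'r::comm_ring_1 mat set" where
  "SO n = {g \<in> carrier (SL n). transpose_mat g * g = 1\<^sub>m n}"

text \<open>The ring of formal power series is regarded as a subring of the field of formal Laurent
  series through \<^const>\<open>fps_to_fls\<close>, and setting the indeterminate to zero is taking the
  coefficient of index 0.\<close>

definition Iwahori :: "nat \<Rightarrow> 'k::field fls mat set" where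
  "Iwahori n = map_mat fps_to_fls `
     {M \<in> carrier (SL n). upper_triangular (map_mat (\<lambda>f. fps_nth f 0) M)}"

definition double_coset :: "('a, 'b) monoid_scheme \<Rightarrow> 'a set \<Rightarrow> 'a \<Rightarrow> 'a set \<Rightarrow> 'a set" where
  "double_coset G K g B = (K #>\<^bsub>G\<^esub> g) <#>\<^bsub>G\<^esub> B"

definition double_cosets :: "('a, 'b) monoid_scheme \<Rightarrow> 'a set \<Rightarrow> 'a set \<Rightarrow> 'a set set" where
  "double_cosets G K B = {double_coset G K g B |g. g \<in> carrier G}"

definition monomial_mat :: "nat \<Rightarrow> 'r::zero mat \<Rightarrow> bool" where
  "monomial_mat n w \<longleftrightarrow> w \<in> carrier_mat n n \<and>
     (\<forall>r<n. \<exists>!c. c < n \<and> w $$ (r, c) \<noteq> 0) \<and>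
     (\<forall>c<n. \<exists>!r. r < n \<and> w $$ (r, c) \<noteq> 0)"

text \<open>The element \<open>\<iota>\<close> is the chosen square root of \<open>-1\<close>. Matrix indices start at 0, so the
  first row and column have index 0.\<close>

definition iSymAPM :: "'k::field \<Rightarrow> nat \<Rightarrow> 'k fls mat set" where
  "iSymAPM \<iota> n = {w \<in> carrier (SL n). monomial_mat n w \<and> transpose_mat w = w \<and>
     ((\<exists>r<n. w $$ (r, r) \<noteq> 0) \<longrightarrow>
        (\<forall>r<n. w $$ (r, r) \<noteq> 0 \<longrightarrow> (\<exists>a. w $$ (r, r) = fls_X_intpow a)) \<and>
        (\<forall>r<n. \<forall>c<n. r \<noteq> c \<and> w $$ (r, c) \<noteq> 0 \<longrightarrow>
           (\<exists>a. w $$ (r, c) = fls_const \<iota> * fls_X_intpow a))) \<and>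
     (\<not> (\<exists>r<n. w $$ (r, r) \<noteq> 0) \<longrightarrow>
        (\<forall>r<n. \<forall>c<n. (r = 0 \<or> c = 0) \<and> w $$ (r, c) \<noteq> 0 \<longrightarrow>
           (\<exists>a. w $$ (r, c) = fls_const \<iota> * fls_X_intpow a \<or>
                w $$ (r, c) = - fls_const \<iota> * fls_X_intpow a)) \<and>
        (\<forall>r<n. \<forall>c<n. r \<noteq> 0 \<and> c \<noteq> 0 \<and> w $$ (r, c) \<noteq> 0 \<longrightarrow>
           (\<exists>a. w $$ (r, c) = fls_const \<iota> * fls_X_intpow a)))}"

end

theory Submission
  imports Defs
begin

text \<open>Put \<open>S = g\<^sup>T g\<close>. Left multiplication of \<open>g\<close> by the orthogonal group does not change \<open>S\<close>, and
  right multiplication by \<open>b\<close> replaces \<open>S\<close> by \<open>b\<^sup>T S b\<close>. So the claim is about symmetric matrices of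
  determinant 1 up to congruence by the Iwahori subgroup: every class contains exactly one of the
  normalised monomial matrices, and every such matrix is a Gram matrix \<open>g\<^sup>T g\<close>.

  Existence (\<open>iSymAPM_representative\<close>) is a Gauss elimination that respects the Iwahori subgroup,
  that is, which adds to a basis vector multiples of an earlier one by elements of \<open>A\<close>, and
  multiples of a later one by elements of \<open>t A\<close>. As pivot one takes an entry \<open>(r, c)\<close> of minimal
  order and, among those, with lexicographically minimal position. If \<open>r = c\<close>, the \<open>r\<close>-th basis
  vector splits off. If \<open>r < c\<close>, the plane spanned by the two basis vectors splits off; the order
  of its diagonal entry at \<open>r\<close> is then larger than that of the pivot, so its discriminant is a
  square, and it has a basis of isotropic vectors that is admissible (\<open>isotropic_basis\<close>). This is
  the elimination step \<open>split_off\<close>. Once the matrix is monomial, scaling by units of \<open>A\<close>, which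
  have square roots, normalises its coefficients. The determinant of the result is a power of \<open>t\<close>
  and also the square \<open>\<delta>\<^sup>2\<close> of a unit, so \<open>\<delta> = \<plusminus>1\<close>; a sign \<open>-1\<close> is absorbed at a fixed point of
  the underlying involution or, if there is none, in the first row and column.

  Uniqueness (\<open>iSymAPM_unique\<close>): let \<open>w' = b\<^sup>T w b\<close>, and let \<open>w\<close> and \<open>w'\<close> have underlying involutions
  \<open>\<sigma>\<close> and \<open>\<tau>\<close>. The entry of \<open>w b = (b\<inverse>)\<^sup>T w'\<close> at \<open>(r, \<tau> r)\<close> is a single product on either side.
  Comparing orders shows that the exponent of \<open>w'\<close> in row \<open>r\<close> is at least that of \<open>w\<close>, and larger
  if \<open>\<tau> r < \<sigma> r\<close>. By symmetry the exponents agree and \<open>\<sigma> = \<tau>\<close>. Comparing leading coefficients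
  shows that those of \<open>w'\<close> and \<open>w\<close> differ by the factor \<open>d r * d (\<sigma> r)\<close>, where \<open>d\<close> is the diagonal of
  \<open>b\<close> modulo \<open>t\<close>. If \<open>\<sigma>\<close> has no fixed point, the product of these factors over all two-cycles is
  \<open>det b = 1\<close> modulo \<open>t\<close>, which fixes the sign in the first row.

  For the last part (\<open>iSymAPM_Gram\<close>), the two-cycles of \<open>w\<close> and the diagonal entries with even
  exponent are Gram matrices, and so is a pair of diagonal entries with odd exponents. The
  exponents add up to 0, hence the number of odd ones on the diagonal is even. Finally, two
  solutions of \<open>g\<^sup>T g = w\<close> differ by an orthogonal matrix on the left.\<close>

section \<open>The valuation filtration on Laurent series\<close>

text \<open>Membership in the fractional ideal \<open>t\<^sup>m A\<close>. The zero series lies in all of these, which is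
  why this is more convenient than a bound on \<^const>\<open>fls_subdegree\<close>.\<close>

definition ord_ge :: "int \<Rightarrow> 'k::zero fls \<Rightarrow> bool" where
  "ord_ge m f \<longleftrightarrow> (\<forall>k<m. fls_nth f k = 0)"

lemma ord_ge_0 [simp]: "ord_ge m 0"
  by (simp add: ord_ge_def)

lemma ord_ge_iff: "ord_ge m f \<longleftrightarrow> f = 0 \<or> m \<le> fls_subdegree f"
  using nth_fls_subdegree_nonzero[of f]
  by (cases "f = 0") (auto simp: ord_ge_def intro: fls_subdegree_geI simp: not_less)

lemma ord_ge_mono: "ord_ge m f \<Longrightarrow> k \<le> m \<Longrightarrow> ord_ge k f"
  by (simp add: ord_ge_def)

lemma ord_ge_add: "ord_ge m f \<Longrightarrow> ord_ge m g \<Longrightarrow> ord_ge m (f + g)" for f :: "'k::comm_ring_1 fls"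
  by (simp add: ord_ge_def)

lemma ord_ge_diff: "ord_ge m f \<Longrightarrow> ord_ge m g \<Longrightarrow> ord_ge m (f - g)" for f :: "'k::comm_ring_1 fls"
  by (simp add: ord_ge_def)

lemma ord_ge_uminus [simp]: "ord_ge m (- f) \<longleftrightarrow> ord_ge m f" for f :: "'k::comm_ring_1 fls"
  by (simp add: ord_ge_def)

lemma ord_ge_Suc: "ord_ge m f \<Longrightarrow> fls_nth f m = 0 \<Longrightarrow> ord_ge (m + 1) f"
  unfolding ord_ge_def by (metis linorder_neqE_linordered_idom zless_add1_eq)

lemma ord_ge_const [simp]: "ord_ge 0 (fls_const c)"
  by (simp add: ord_ge_def)

lemma ord_ge_1 [simp]: "ord_ge 0 (1 :: 'k::comm_ring_1 fls)"
  by (simp add: ord_ge_def)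

lemma ord_ge_shift: "ord_ge m (fls_shift k f) \<longleftrightarrow> ord_ge (m + k) f"
  unfolding ord_ge_def
  by (metis add.commute add_less_cancel_left diff_add_cancel fls_shift_nth uminus_add_conv_diff)

lemma ord_ge_fps [simp]: "ord_ge 0 (fps_to_fls f)"
  by (simp add: ord_ge_def)

lemma fps_to_fls_regpart: "ord_ge 0 f \<Longrightarrow> fps_to_fls (fls_regpart f) = f"
  by (intro fls_eqI) (simp add: ord_ge_def)

lemma ord_ge_0_mult:
  fixes f g :: "'k::comm_ring_1 fls"
  assumes "ord_ge 0 f" "ord_ge 0 g"
  shows "ord_ge 0 (f * g)" "fls_nth (f * g) 0 = fls_nth f 0 * fls_nth g 0"
proof -
  have "f * g = fps_to_fls (fls_regpart f * fls_regpart g)"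
    using assms by (simp add: fls_times_fps_to_fls fps_to_fls_regpart)
  then show "ord_ge 0 (f * g)" "fls_nth (f * g) 0 = fls_nth f 0 * fls_nth g 0"
    by simp_all
qed

lemma
  fixes f g :: "'k::comm_ring_1 fls"
  assumes "ord_ge a f" "ord_ge b g"
  shows ord_ge_mult: "ord_ge (a + b) (f * g)"
    and nth_mult_ord_ge: "fls_nth (f * g) (a + b) = fls_nth f a * fls_nth g b"
proof -
  have *: "fls_shift a f * fls_shift b g = fls_shift (a + b) (f * g)"
    by (simp add: fls_times_both_shifted_simp)
  have "ord_ge 0 (fls_shift a f)" "ord_ge 0 (fls_shift b g)"
    using assms by (simp_all add: ord_ge_shift)
  from ord_ge_0_mult[OF this, unfolded *]
  show "ord_ge (a + b) (f * g)" "fls_nth (f * g) (a + b) = fls_nth f a * fls_nth g b"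
    by (simp_all add: ord_ge_shift)
qed

text \<open>A series of order exactly \<open>m\<close>; for \<open>m = 0\<close> these are the units of \<open>A\<close>.\<close>

definition ord_eq :: "int \<Rightarrow> 'k::zero fls \<Rightarrow> bool" where
  "ord_eq m f \<longleftrightarrow> ord_ge m f \<and> fls_nth f m \<noteq> 0"

lemma ord_eq_iff: "ord_eq m f \<longleftrightarrow> f \<noteq> 0 \<and> fls_subdegree f = m"
  unfolding ord_eq_def ord_ge_def by (auto intro: fls_subdegree_eqI)

lemma ord_eq_subdegree: "f \<noteq> 0 \<Longrightarrow> ord_eq (fls_subdegree f) f"
  by (simp add: ord_eq_iff)

lemma ord_eq_mult: "ord_eq a f \<Longrightarrow> ord_eq b g \<Longrightarrow> ord_eq (a + b) (f * g)" for f :: "'k::field fls"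
  by (simp add: ord_eq_def ord_ge_mult nth_mult_ord_ge)

lemma ord_eq_inverse: "ord_eq a f \<Longrightarrow> ord_eq (- a) (inverse f)" for f :: "'k::field fls"
  by (auto simp: ord_eq_iff)

lemma ord_ge_divide:
  fixes f g :: "'k::field fls"
  assumes "ord_ge a f" "ord_eq b g" "c = a - b"
  shows "ord_ge c (f / g)"
  using ord_ge_mult[OF assms(1), of "- b" "inverse g"] ord_eq_inverse[OF assms(2)] assms(3)
  by (simp add: ord_eq_def divide_inverse)

lemma ord_eq_divide:
  fixes f g :: "'k::field fls"
  assumes "ord_eq a f" "ord_eq b g" "c = a - b"
  shows "ord_eq c (f / g)"
  using ord_eq_mult[OF assms(1) ord_eq_inverse[OF assms(2)]] assms(3) by (simp add: divide_inverse)

lemma ord_eq_0_const [simp]: "ord_eq 0 (fls_const c) \<longleftrightarrow> c \<noteq> 0"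
  by (simp add: ord_eq_def)

lemma ord_eq_X_intpow [simp]: "ord_eq m (fls_X_intpow a :: 'k::field fls) \<longleftrightarrow> m = a"
  by (auto simp: ord_eq_iff)

section \<open>Square roots of units\<close>

text \<open>The coefficients of a square root with prescribed constant term \<open>y\<close>, by recursion. Only
  division by \<open>2 y\<close> is needed, so the construction works in every characteristic other than 2.\<close>

fun sqrt_coeff :: "(nat \<Rightarrow> 'k::field) \<Rightarrow> 'k \<Rightarrow> nat \<Rightarrow> 'k" where
  "sqrt_coeff a y n = (if n = 0 then y
     else (a n - (\<Sum>i\<in>{0<..<n}. sqrt_coeff a y i * sqrt_coeff a y (n - i))) / (2 * y))"

declare sqrt_coeff.simps [simp del]

lemma fps_sqrt_exists:
  fixes a :: "'k::field fps"
  assumes two: "(2::'k) \<noteq> 0" and y: "y\<^sup>2 = fps_nth a 0" "y \<noteq> 0"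
  shows "\<exists>z. z\<^sup>2 = a \<and> fps_nth z 0 = y"
proof (intro exI conjI)
  define s where "s = sqrt_coeff (fps_nth a) y"
  define z where "z = Abs_fps s"
  have s0: "s 0 = y"
    by (simp add: s_def sqrt_coeff.simps)
  show "z\<^sup>2 = a"
  proof (rule fps_ext)
    fix n
    have sq: "fps_nth (z\<^sup>2) n = (\<Sum>i=0..n. s i * s (n - i))"
      by (simp add: power2_eq_square fps_mult_nth z_def)
    show "fps_nth (z\<^sup>2) n = fps_nth a n"
    proof (cases "n = 0")
      case True
      then show ?thesis
        using sq s0 y by (simp add: power2_eq_square)
    next
      case False
      have "{0..n} = insert 0 (insert n {0<..<n})"
        using False by auto
      then have "fps_nth (z\<^sup>2) n = 2 * y * s n + (\<Sum>i\<in>{0<..<n}. s i * s (n - i))"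
        using sq False s0 by (simp add: algebra_simps)
      moreover have "s n = (fps_nth a n - (\<Sum>i\<in>{0<..<n}. s i * s (n - i))) / (2 * y)"
        unfolding s_def using False by (subst sqrt_coeff.simps) simp
      ultimately show ?thesis
        using two y(2) by simp
    qed
  qed
  show "fps_nth z 0 = y"
    by (simp add: z_def s0)
qed

lemma unit_sqrt_exists:
  fixes u :: "'k::field fls"
  assumes "(2::'k) \<noteq> 0" and "ord_ge 0 u" and "y\<^sup>2 = fls_nth u 0" "y \<noteq> 0"
  shows "\<exists>z. z\<^sup>2 = u \<and> ord_ge 0 z \<and> fls_nth z 0 = y"
proof -
  obtain z where "z\<^sup>2 = fls_regpart u" "fps_nth z 0 = y"
    using fps_sqrt_exists[of y "fls_regpart u"] assms by auto
  then have "(fps_to_fls z)\<^sup>2 = u" "fls_nth (fps_to_fls z) 0 = y"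
    using assms(2) by (simp_all add: fps_to_fls_power[symmetric] fps_to_fls_regpart)
  then show ?thesis
    by (metis ord_ge_fps)
qed

section \<open>The Iwahori subgroup\<close>

text \<open>The Iwahori subgroup of the general linear group, described entrywise over the field of
  Laurent series.\<close>

definition Iwahori_GL :: "nat \<Rightarrow> 'k::field fls mat set" where
  "Iwahori_GL n = {b \<in> carrier_mat n n.
     (\<forall>i<n. \<forall>j<n. ord_ge (if j < i then 1 else 0) (b $$ (i, j))) \<and> (\<forall>i<n. ord_eq 0 (b $$ (i, i)))}"

lemma Iwahori_GL_carrier: "b \<in> Iwahori_GL n \<Longrightarrow> b \<in> carrier_mat n n"
  by (simp add: Iwahori_GL_def)

interpretation fps_to_fls_hom: comm_ring_hom "fps_to_fls :: 'k::comm_ring_1 fps \<Rightarrow> 'k fls"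
  by unfold_locales (simp_all add: fls_times_fps_to_fls)

interpretation fps_nth_0_hom: comm_ring_hom "\<lambda>f :: 'k::comm_ring_1 fps. fps_nth f 0"
  by unfold_locales simp_all

text \<open>Reduction modulo \<open>t\<close>.\<close>

abbreviation const_mat :: "'k::field fls mat \<Rightarrow> 'k mat" where
  "const_mat b \<equiv> map_mat (\<lambda>f. fls_nth f 0) b"

lemma Iwahori_GL_fps:
  assumes "b \<in> Iwahori_GL n"
  obtains M where "M \<in> carrier_mat n n" "map_mat fps_to_fls M = b"
    "map_mat (\<lambda>f. fps_nth f 0) M = const_mat b"
proof
  have b: "b \<in> carrier_mat n n"
    using assms by (rule Iwahori_GL_carrier)
  have "ord_ge 0 (b $$ (i, j))" if "i < n" "j < n" for i j
    using assms that by (auto simp: Iwahori_GL_def intro: ord_ge_mono[of "if j < i then 1 else 0"])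
  then show "map_mat fps_to_fls (map_mat fls_regpart b) = b"
    using b by (intro eq_matI) (simp_all add: fps_to_fls_regpart)
  show "map_mat fls_regpart b \<in> carrier_mat n n"
    "map_mat (\<lambda>f. fps_nth f 0) (map_mat fls_regpart b) = const_mat b"
    using b by (auto intro!: eq_matI)
qed

lemma Iwahori_GL_iff:
  "b \<in> Iwahori_GL n \<longleftrightarrow> b \<in> carrier_mat n n \<and> (\<forall>i<n. \<forall>j<n. ord_ge 0 (b $$ (i, j))) \<and>
     upper_triangular (const_mat b) \<and> (\<forall>i<n. const_mat b $$ (i, i) \<noteq> 0)"
  (is "_ \<longleftrightarrow> ?R")
proof
  assume b: "b \<in> Iwahori_GL n"
  have "ord_ge 0 (b $$ (i, j))" if "i < n" "j < n" for i j
    using b that by (auto simp: Iwahori_GL_def intro: ord_ge_mono[of "if j < i then 1 else 0"])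
  moreover have "fls_nth (b $$ (i, j)) 0 = 0" if "i < n" "j < i" for i j
  proof -
    have "\<forall>i<n. \<forall>j<n. ord_ge (if j < i then 1 else 0) (b $$ (i, j))"
      using b unfolding Iwahori_GL_def by simp
    from this[rule_format, of i j] have "ord_ge 1 (b $$ (i, j))"
      using that by simp
    then show ?thesis
      by (simp add: ord_ge_def)
  qed
  ultimately show ?R
    using b by (auto simp: Iwahori_GL_def ord_eq_def)
next
  assume R: ?R
  have "ord_ge 1 (b $$ (i, j))" if "i < n" "j < i" for i j
  proof -
    have "const_mat b $$ (i, j) = 0"
      using R that by (intro upper_triangularD) auto
    moreover have "j < n"
      using that by simp
    ultimately show ?thesis
      using R that ord_ge_Suc[of 0 "b $$ (i, j)"] by auto
  qed
  then show "b \<in> Iwahori_GL n"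
    using R by (auto simp: Iwahori_GL_def ord_eq_def)
qed

lemma Iwahori_GL_det:
  assumes "b \<in> Iwahori_GL n"
  shows "ord_eq 0 (det b)" "fls_nth (det b) 0 = (\<Prod>i<n. fls_nth (b $$ (i, i)) 0)"
proof -
  obtain M where M: "M \<in> carrier_mat n n" "map_mat fps_to_fls M = b"
    "map_mat (\<lambda>f. fps_nth f 0) M = const_mat b"
    using Iwahori_GL_fps[OF assms] by blast
  note b = assms[unfolded Iwahori_GL_iff]
  have det: "det b = fps_to_fls (det M)"
    by (simp flip: M(2))
  have "fps_nth (det M) 0 = det (const_mat b)"
    unfolding M(3)[symmetric] by (simp only: fps_nth_0_hom.hom_det)
  also have "\<dots> = prod_list (diag_mat (const_mat b))"
    using b by (intro det_upper_triangular[of _ n]) auto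
  also have "\<dots> = (\<Prod>i<n. fls_nth (b $$ (i, i)) 0)"
    using b by (auto simp: prod_list_diag_prod atLeast0LessThan)
  finally show *: "fls_nth (det b) 0 = (\<Prod>i<n. fls_nth (b $$ (i, i)) 0)"
    by (simp add: det)
  have "ord_ge 0 (det b)"
    by (simp add: det)
  then show "ord_eq 0 (det b)"
    using b by (auto simp: ord_eq_def *)
qed

lemma upper_triangular_mult:
  fixes A B :: "'a::comm_ring_1 mat"
  assumes "A \<in> carrier_mat n n" "B \<in> carrier_mat n n" "upper_triangular A" "upper_triangular B"
  shows "upper_triangular (A * B)" "i < n \<Longrightarrow> (A * B) $$ (i, i) = A $$ (i, i) * B $$ (i, i)"
proof -
  have AB: "(A * B) $$ (i, j) = (\<Sum>k\<in>{0..<n}. A $$ (i, k) * B $$ (k, j))" if "i < n" "j < n" for i j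
    using assms that by (simp add: scalar_prod_def)
  have A0: "A $$ (i, k) = 0" if "k < i" "i < n" for i k
    using assms that by (intro upper_triangularD) auto
  have B0: "B $$ (i, k) = 0" if "k < i" "i < n" for i k
    using assms that by (intro upper_triangularD) auto
  show "upper_triangular (A * B)"
  proof (rule upper_triangularI)
    fix i j assume "j < i" "i < dim_row (A * B)"
    then have ij: "j < i" "i < n"
      using assms by auto
    have "A $$ (i, k) * B $$ (k, j) = 0" if "k \<in> {0..<n}" for k
      using A0[of k i] B0[of j k] ij that by (cases "k < i") auto
    then show "(A * B) $$ (i, j) = 0"
      using ij by (simp add: AB)
  qed
  assume i: "i < n"
  have "(A * B) $$ (i, i) = (\<Sum>k\<in>{0..<n}. if k = i then A $$ (i, i) * B $$ (i, i) else 0)"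
    unfolding AB[OF i i] using A0[of _ i] B0[of i] i
    by (intro sum.cong refl) (metis atLeastLessThan_iff linorder_neqE_nat mult_zero_left mult_zero_right)
  then show "(A * B) $$ (i, i) = A $$ (i, i) * B $$ (i, i)"
    using i by simp
qed

lemma upper_triangular_inverse:
  fixes A B :: "'a::field mat"
  assumes "A \<in> carrier_mat n n" "B \<in> carrier_mat n n" "upper_triangular A" "B * A = 1\<^sub>m n"
    and diag: "\<And>i. i < n \<Longrightarrow> A $$ (i, i) \<noteq> 0"
  shows "upper_triangular B"
proof (rule upper_triangularI)
  fix i j assume "j < i" "i < dim_row B"
  then have "j < i" "i < n"
    using assms by auto
  then show "B $$ (i, j) = 0"
  proof (induction j rule: less_induct)
    case (less j)
    have A0: "A $$ (k, j) = 0" if "j < k" "k < n" for k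
      using assms that by (intro upper_triangularD) auto
    have "0 = (B * A) $$ (i, j)"
      using less assms by simp
    also have "\<dots> = (\<Sum>k\<in>{0..<n}. B $$ (i, k) * A $$ (k, j))"
      using less assms(1,2) by (simp add: scalar_prod_def)
    also have "\<dots> = (\<Sum>k\<in>{0..<n}. if k = j then B $$ (i, j) * A $$ (j, j) else 0)"
      using less A0
      by (intro sum.cong refl) (metis atLeastLessThan_iff linorder_neqE_nat mult_zero_left
          mult_zero_right order.strict_trans)
    also have "\<dots> = B $$ (i, j) * A $$ (j, j)"
      using less by simp
    finally show ?case
      using diag[of j] less by simp
  qed
qed

lemma const_mat_mult:
  assumes "a \<in> Iwahori_GL n" "b \<in> Iwahori_GL n"
  shows "const_mat (a * b) = const_mat a * const_mat b"
    and "i < n \<Longrightarrow> j < n \<Longrightarrow> ord_ge 0 ((a * b) $$ (i, j))"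
proof -
  obtain M where M: "M \<in> carrier_mat n n" "map_mat fps_to_fls M = a"
    "map_mat (\<lambda>f. fps_nth f 0) M = const_mat a"
    using Iwahori_GL_fps[OF assms(1)] by blast
  obtain N where N: "N \<in> carrier_mat n n" "map_mat fps_to_fls N = b"
    "map_mat (\<lambda>f. fps_nth f 0) N = const_mat b"
    using Iwahori_GL_fps[OF assms(2)] by blast
  have ab: "a * b = map_mat fps_to_fls (M * N)"
    using fps_to_fls_hom.mat_hom_mult[OF M(1) N(1)] M N by simp
  then have "const_mat (a * b) = map_mat (\<lambda>f. fps_nth f 0) (M * N)"
    using M N by (auto intro!: eq_matI)
  also have "\<dots> = const_mat a * const_mat b"
    using fps_nth_0_hom.mat_hom_mult[OF M(1) N(1)] M N by simp
  finally show "const_mat (a * b) = const_mat a * const_mat b" .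
  show "i < n \<Longrightarrow> j < n \<Longrightarrow> ord_ge 0 ((a * b) $$ (i, j))"
    using M N by (simp add: ab)
qed

lemma Iwahori_GL_mult:
  assumes "a \<in> Iwahori_GL n" "b \<in> Iwahori_GL n"
  shows "a * b \<in> Iwahori_GL n"
proof -
  note a = assms(1)[unfolded Iwahori_GL_iff] and b = assms(2)[unfolded Iwahori_GL_iff]
  have "upper_triangular (const_mat a * const_mat b)"
    and "i < n \<Longrightarrow> (const_mat a * const_mat b) $$ (i, i) = const_mat a $$ (i, i) * const_mat b $$ (i, i)"
    for i
    using a b by (auto intro!: upper_triangular_mult[of _ n])
  then show ?thesis
    unfolding Iwahori_GL_iff const_mat_mult(1)[OF assms] using a b const_mat_mult(2)[OF assms]
    by (simp del: index_map_mat index_mult_mat) (auto intro!: mult_carrier_mat)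
qed

lemma one_Iwahori_GL: "1\<^sub>m n \<in> Iwahori_GL n"
  by (auto simp: Iwahori_GL_def ord_eq_def)

lemma Iwahori_iff: "b \<in> Iwahori n \<longleftrightarrow> b \<in> Iwahori_GL n \<and> det b = 1"
proof
  assume "b \<in> Iwahori n"
  then obtain M where M: "b = map_mat fps_to_fls M" "M \<in> carrier_mat n n" "det M = 1"
    "upper_triangular (map_mat (\<lambda>f. fps_nth f 0) M)"
    by (auto simp: Iwahori_def SL_def)
  have const: "const_mat b = map_mat (\<lambda>f. fps_nth f 0) M"
    using M by (auto intro!: eq_matI)
  have "det (const_mat b) = 1"
    unfolding const fps_nth_0_hom.hom_det by (simp add: M)
  moreover have "const_mat b \<in> carrier_mat n n"
    using M by simp
  moreover have "upper_triangular (const_mat b)"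
    using M(4) const by simp
  ultimately have "0 \<notin> set (diag_mat (const_mat b))"
    using upper_triangular_imp_det_eq_0_iff[of "const_mat b" n] by simp
  then have "\<forall>i<n. const_mat b $$ (i, i) \<noteq> 0"
    using \<open>const_mat b \<in> carrier_mat n n\<close> by (auto simp: diag_mat_def image_iff simp del: index_map_mat) 
  then show "b \<in> Iwahori_GL n \<and> det b = 1"
    using M const unfolding Iwahori_GL_iff by auto
next
  assume b: "b \<in> Iwahori_GL n \<and> det b = 1"
  then obtain M where M: "M \<in> carrier_mat n n" "map_mat fps_to_fls M = b"
    "map_mat (\<lambda>f. fps_nth f 0) M = const_mat b"
    using Iwahori_GL_fps by blast
  have "fps_to_fls (det M) = 1"
    using b by (simp flip: M(2))
  then show "b \<in> Iwahori n"
    using M b unfolding Iwahori_def Iwahori_GL_iff SL_def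
    by (auto intro!: image_eqI[of _ _ M])
qed

lemma SL_inverse:
  fixes g :: "'a::comm_ring_1 mat"
  assumes "g \<in> carrier_mat n n" "det g = 1"
  obtains h where "h \<in> carrier_mat n n" "det h = 1" "g * h = 1\<^sub>m n" "h * g = 1\<^sub>m n"
proof
  show h: "adj_mat g \<in> carrier_mat n n" "g * adj_mat g = 1\<^sub>m n" "adj_mat g * g = 1\<^sub>m n"
    using adj_mat[OF assms(1)] assms(2) by (auto intro!: eq_matI)
  have "det g * det (adj_mat g) = 1"
    using det_mult[OF assms(1) h(1)] h by simp
  then show "det (adj_mat g) = 1"
    using assms by simp
qed

lemma Iwahori_inverse:
  fixes b :: "'k::field fls mat"
  assumes "b \<in> Iwahori n"
  obtains c where "c \<in> Iwahori n" "b * c = 1\<^sub>m n" "c * b = 1\<^sub>m n"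
    "\<forall>i<n. fls_nth (b $$ (i, i)) 0 * fls_nth (c $$ (i, i)) 0 = 1"
proof -
  obtain M where M: "b = map_mat fps_to_fls M" "M \<in> carrier_mat n n" "det M = 1"
    "upper_triangular (map_mat (\<lambda>f. fps_nth f 0) M)"
    using assms by (auto simp: Iwahori_def SL_def)
  have const: "const_mat b = map_mat (\<lambda>f. fps_nth f 0) M"
    using M by (auto intro!: eq_matI)
  have bG: "b \<in> Iwahori_GL n"
    using assms by (simp add: Iwahori_iff)
  note b = this[unfolded Iwahori_GL_iff]
  obtain N where N: "N \<in> carrier_mat n n" "det N = 1" "M * N = 1\<^sub>m n" "N * M = 1\<^sub>m n"
    using SL_inverse[OF M(2,3)] .
  define c where "c = map_mat fps_to_fls N"
  have const': "const_mat c = map_mat (\<lambda>f. fps_nth f 0) N"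
    using N by (auto intro!: eq_matI simp: c_def)
  have "const_mat c * const_mat b = 1\<^sub>m n"
    unfolding const const' using fps_nth_0_hom.mat_hom_mult[OF N(1) M(2)] N 
    by (simp add: fps_nth_0_hom.mat_hom_one)
  moreover have "const_mat c \<in> carrier_mat n n" "const_mat b \<in> carrier_mat n n"
    using N b by (auto simp: c_def)
  ultimately have "upper_triangular (const_mat c)"
    using upper_triangular_inverse[of "const_mat b" n "const_mat c"] b by auto
  then have c: "c \<in> Iwahori n"
    unfolding Iwahori_def SL_def c_def using N const' by (auto simp: c_def)
  have bc: "b * c = 1\<^sub>m n" "c * b = 1\<^sub>m n"
    using fps_to_fls_hom.mat_hom_mult[OF N(1) M(2)] fps_to_fls_hom.mat_hom_mult[OF M(2) N(1)] N
    by (simp_all add: c_def M(1) fps_to_fls_hom.mat_hom_one)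
  have cG: "c \<in> Iwahori_GL n"
    using c by (simp add: Iwahori_iff)
  have "fls_nth (b $$ (i, i)) 0 * fls_nth (c $$ (i, i)) 0 = 1" if i: "i < n" for i
  proof -
    have "(const_mat b * const_mat c) $$ (i, i) = const_mat b $$ (i, i) * const_mat c $$ (i, i)"
      using b cG[unfolded Iwahori_GL_iff] i by (intro upper_triangular_mult[of _ n]) auto
    moreover have "const_mat b * const_mat c = const_mat (1\<^sub>m n)"
      using const_mat_mult(1)[OF bG cG] bc by simp
    moreover have "const_mat (1\<^sub>m n :: 'k fls mat) $$ (i, i) = 1"
      using i by simp
    moreover have "const_mat b $$ (i, i) = fls_nth (b $$ (i, i)) 0"
        "const_mat c $$ (i, i) = fls_nth (c $$ (i, i)) 0"
      using i b cG[unfolded Iwahori_GL_iff] by auto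
    ultimately show ?thesis
      by argo
  qed
  then show thesis
    using that c bc by blast
qed

section \<open>Reduction of symmetric matrices to monomial form\<close>

text \<open>The matrix of the bilinear form \<open>S\<close> with respect to the basis given by the columns of \<open>b\<close>.\<close>

abbreviation congr_mat :: "'a::comm_ring_1 mat \<Rightarrow> 'a mat \<Rightarrow> 'a mat" where
  "congr_mat b S \<equiv> transpose_mat b * S * b"

lemma congr_mat_carrier: "b \<in> carrier_mat n n \<Longrightarrow> S \<in> carrier_mat n n \<Longrightarrow> congr_mat b S \<in> carrier_mat n n"
  by (intro mult_carrier_mat) auto

lemma congr_mat_index:
  assumes "b \<in> carrier_mat n n" "S \<in> carrier_mat n n" "x < n" "y < n"
  shows "congr_mat b S $$ (x, y) = (\<Sum>k<n. b $$ (k, x) * (\<Sum>l<n. S $$ (k, l) * b $$ (l, y)))"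
proof -
  have "congr_mat b S = transpose_mat b * (S * b)"
    using assms by (intro assoc_mult_mat[of _ n n _ n _ n]) auto
  then show ?thesis
    using assms by (simp add: scalar_prod_def atLeast0LessThan)
qed

lemma congr_mat_symmetric:
  assumes "b \<in> carrier_mat n n" "S \<in> carrier_mat n n" "transpose_mat S = S"
  shows "transpose_mat (congr_mat b S) = congr_mat b S"
proof -
  have "transpose_mat (congr_mat b S) = transpose_mat b * (transpose_mat S * b)"
    using assms by (subst transpose_mult[of _ n n _ n]) (auto simp: transpose_mult[of _ n n _ n])
  then show ?thesis
    using assms by (simp add: assoc_mult_mat[of _ n n _ n _ n])
qed

lemma congr_mat_mult:
  assumes "a \<in> carrier_mat n n" "b \<in> carrier_mat n n" "S \<in> carrier_mat n n"
  shows "congr_mat b (congr_mat a S) = congr_mat (a * b) S"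
proof -
  have "transpose_mat b * (transpose_mat a * S * a) * b = transpose_mat b * transpose_mat a * S * (a * b)"
    using assms by (simp add: assoc_mult_mat[of _ n n _ n _ n] mult_carrier_mat[of _ n n _ n])
  then show ?thesis
    using assms by (simp add: transpose_mult[of _ n n _ n])
qed

lemma congr_mat_det:
  assumes "b \<in> carrier_mat n n" "S \<in> carrier_mat n n"
  shows "det (congr_mat b S) = (det b)\<^sup>2 * det S"
  using assms by (simp add: det_mult[of _ n] det_transpose power2_eq_square)

lemma symmetric_index: "transpose_mat S = S \<Longrightarrow> S \<in> carrier_mat n n \<Longrightarrow> i < n \<Longrightarrow> j < n \<Longrightarrow> S $$ (i, j) = S $$ (j, i)"
  by (metis carrier_matD index_transpose_mat(1))

text \<open>The rows with index in \<open>I\<close> are those that have been reduced: such a row has a single nonzero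
  entry, and its column index is again in \<open>I\<close>.\<close>

definition reduced_rows :: "nat \<Rightarrow> nat set \<Rightarrow> 'a::zero mat \<Rightarrow> bool" where
  "reduced_rows n I S \<longleftrightarrow> I \<subseteq> {..<n} \<and> (\<forall>r\<in>I. \<exists>c\<in>I. \<forall>j<n. S $$ (r, j) \<noteq> 0 \<longleftrightarrow> j = c)"

text \<open>One elimination step. A set \<open>R\<close> of indices not yet reduced is split off as an orthogonal
  summand: combinations of the basis vectors in \<open>R\<close>, with coefficients \<open>X\<close>, are added to the basis
  vectors outside \<open>R\<close>, and the basis vectors in \<open>R\<close> are changed among themselves. The assumption
  \<open>clear\<close> says that the new vectors outside \<open>R\<close> are orthogonal to those in \<open>R\<close>, and \<open>block\<close> that the
  form on the span of \<open>R\<close> becomes monomial.\<close>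

lemma split_off:
  fixes S :: "'k::field fls mat" and X :: "nat \<Rightarrow> nat \<Rightarrow> 'k fls"
  assumes S: "S \<in> carrier_mat n n" "transpose_mat S = S"
    and I: "reduced_rows n I S"
    and R: "R \<subseteq> {..<n}" "R \<inter> I = {}"
    and X: "\<And>i j. i \<in> R \<Longrightarrow> j < n \<Longrightarrow> ord_ge (if j < i then 1 else 0) (X i j)"
    and Xdiag: "\<And>i. i \<in> R \<Longrightarrow> ord_eq 0 (X i i)"
    and XI: "\<And>i j. i \<in> R \<Longrightarrow> j \<in> I \<Longrightarrow> X i j = 0"
    and clear: "\<And>k y. k \<in> R \<Longrightarrow> y < n \<Longrightarrow> y \<notin> R \<Longrightarrow> S $$ (k, y) + (\<Sum>i\<in>R. S $$ (k, i) * X i y) = 0"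
    and block: "\<And>k. k \<in> R \<Longrightarrow> \<exists>c\<in>R. \<forall>l\<in>R. (\<Sum>i\<in>R. X i k * (\<Sum>j\<in>R. S $$ (i, j) * X j l)) \<noteq> 0 \<longleftrightarrow> l = c"
  shows "\<exists>b \<in> Iwahori_GL n. reduced_rows n (I \<union> R) (congr_mat b S)"
proof
  define b where "b = mat n n (\<lambda>(i, j). if i \<in> R then X i j else if i = j then 1 else 0)"
  have bc: "b \<in> carrier_mat n n"
    by (simp add: b_def)
  have b: "b $$ (i, j) = (if i \<in> R then X i j else if i = j then 1 else 0)" if "i < n" "j < n" for i j
    using that by (simp add: b_def)
  show "b \<in> Iwahori_GL n"
    using X Xdiag by (auto simp: Iwahori_GL_def bc b ord_eq_def)
  have finR: "finite R"
    using R finite_subset by blast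
  have In: "I \<subseteq> {..<n}"
    using I by (simp add: reduced_rows_def)
  have split: "(\<Sum>l<n. f l * b $$ (l, y)) = (if y \<in> R then 0 else f y) + (\<Sum>i\<in>R. f i * X i y)"
    if "y < n" for f y
  proof -
    have "(\<Sum>l<n. f l * b $$ (l, y)) = (\<Sum>l\<in>{..<n} - R. f l * b $$ (l, y)) + (\<Sum>l\<in>R. f l * b $$ (l, y))"
      using R by (intro sum.subset_diff) auto
    also have "(\<Sum>l\<in>R. f l * b $$ (l, y)) = (\<Sum>i\<in>R. f i * X i y)"
      using R that by (intro sum.cong) (auto simp: b)
    also have "(\<Sum>l\<in>{..<n} - R. f l * b $$ (l, y)) = (\<Sum>l\<in>{..<n} - R. if l = y then f y else 0)"
      using R that by (intro sum.cong) (auto simp: b)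
    also have "\<dots> = (if y \<in> R then 0 else f y)"
      using that by simp
    finally show ?thesis .
  qed
  define T where "T k y = (if y \<in> R then 0 else S $$ (k, y)) + (\<Sum>i\<in>R. S $$ (k, i) * X i y)" for k y
  have entry: "congr_mat b S $$ (x, y) = (if x \<in> R then 0 else T x y) + (\<Sum>i\<in>R. X i x * T i y)"
    if "x < n" "y < n" for x y
  proof -
    have "congr_mat b S $$ (x, y) = (\<Sum>k<n. T k y * b $$ (k, x))"
      unfolding congr_mat_index[OF bc S(1) that] using that by (simp add: split T_def mult.commute)
    also have "\<dots> = (if x \<in> R then 0 else T x y) + (\<Sum>i\<in>R. X i x * T i y)"
      using that by (simp add: split mult.commute)
    finally show ?thesis .
  qed
  have sym: "congr_mat b S $$ (x, y) = congr_mat b S $$ (y, x)" if "x < n" "y < n" for x y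
    using symmetric_index[OF congr_mat_symmetric[OF bc S] congr_mat_carrier[OF bc S(1)]] that by blast
  have TR: "T k y = 0" if "k \<in> R" "y < n" "y \<notin> R" for k y
    using clear[OF that] that by (simp add: T_def)
  have out: "congr_mat b S $$ (x, y) = 0" if "x \<in> R" "y < n" "y \<notin> R" for x y
    using entry[of x y] that R TR by (auto intro!: sum.neutral)
  have SI: "S $$ (k, y) = 0" if "y \<in> I" "k < n" "k \<notin> I" for k y
  proof -
    obtain c where "c \<in> I" "\<And>j. j < n \<Longrightarrow> S $$ (y, j) \<noteq> 0 \<Longrightarrow> j = c"
      using I \<open>y \<in> I\<close> unfolding reduced_rows_def by blast
    then have "S $$ (y, k) = 0"
      using that by blast
    then show ?thesis
      using symmetric_index[OF S(2,1), of k y] that In by auto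
  qed
  have old: "congr_mat b S $$ (y, x) = S $$ (y, x)" if "y \<in> I" "x < n" for x y
  proof -
    have y: "y < n" "y \<notin> R"
      using that In R by auto
    have T: "T k y = S $$ (k, y)" if "k < n" for k
      using y XI[OF _ \<open>y \<in> I\<close>] by (simp add: T_def)
    have "T i y = 0" if "i \<in> R" for i
      using that R y TR by simp
    then have "congr_mat b S $$ (x, y) = (if x \<in> R then 0 else S $$ (x, y))"
      using entry[OF \<open>x < n\<close> y(1)] T[OF \<open>x < n\<close>] by simp
    also have "\<dots> = S $$ (x, y)"
      using SI[OF \<open>y \<in> I\<close> \<open>x < n\<close>] R by auto
    finally show ?thesis
      using sym[OF y(1) \<open>x < n\<close>] symmetric_index[OF S(2,1) y(1) \<open>x < n\<close>] by simp
  qed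
  show "reduced_rows n (I \<union> R) (congr_mat b S)"
    unfolding reduced_rows_def
  proof (intro conjI ballI)
    show "I \<union> R \<subseteq> {..<n}"
      using In R by simp
    fix r assume "r \<in> I \<union> R"
    then consider "r \<in> I" | "r \<in> R"
      by blast
    then show "\<exists>c\<in>I \<union> R. \<forall>j<n. congr_mat b S $$ (r, j) \<noteq> 0 \<longleftrightarrow> j = c"
    proof cases
      case 1
      then obtain c where "c \<in> I" "\<forall>j<n. S $$ (r, j) \<noteq> 0 \<longleftrightarrow> j = c"
        using I unfolding reduced_rows_def by blast
      then show ?thesis
        using old[OF 1] by (intro bexI[of _ c]) auto
    next
      case 2
      then have r: "r < n"
        using R by auto
      obtain c where c: "c \<in> R"
        "\<And>l. l \<in> R \<Longrightarrow> (\<Sum>i\<in>R. X i r * (\<Sum>j\<in>R. S $$ (i, j) * X j l)) \<noteq> 0 \<longleftrightarrow> l = c"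
        using block[OF 2] by blast
      have "congr_mat b S $$ (r, j) \<noteq> 0 \<longleftrightarrow> j = c" if "j < n" for j
      proof (cases "j \<in> R")
        case True
        have "congr_mat b S $$ (r, j) = (\<Sum>i\<in>R. X i r * (\<Sum>k\<in>R. S $$ (i, k) * X k j))"
          using entry[OF r that] 2 True by (simp add: T_def)
        then show ?thesis
          using c(2)[OF True] by simp
      next
        case False
        then show ?thesis
          using out[OF 2 that] c(1) by auto
      qed
      then show ?thesis
        using c(1) by blast
    qed
  qed
qed

text \<open>The pivot is chosen of minimal order among the entries not yet reduced, and then with
  minimal row index and minimal column index.\<close>

lemma pivot_exists:
  fixes S :: "'k::field fls mat"
  assumes "finite J" "i0 \<in> J" "j0 \<in> J" "S $$ (i0, j0) \<noteq> 0"
  obtains r c m where "r \<in> J" "c \<in> J" "fls_nth (S $$ (r, c)) m \<noteq> 0"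
    "\<forall>i\<in>J. \<forall>j\<in>J. ord_ge m (S $$ (i, j)) \<and>
      (i < r \<or> i = r \<and> j < (c::nat) \<longrightarrow> ord_ge (m + 1) (S $$ (i, j)))"
proof -
  define D where "D = (\<lambda>(i, j). fls_subdegree (S $$ (i, j))) ` {(i, j) \<in> J \<times> J. S $$ (i, j) \<noteq> 0}"
  have fin: "finite D"
    unfolding D_def using assms(1) by (intro finite_imageI, intro finite_subset[OF _ finite_cartesian_product[OF assms(1,1)]]) auto
  have ne: "D \<noteq> {}"
    using assms by (auto simp: D_def)
  define m where "m = Min D"
  have "m \<in> D"
    using fin ne by (simp add: m_def)
  then have ex: "\<exists>r. r \<in> J \<and> (\<exists>c\<in>J. fls_nth (S $$ (r, c)) m \<noteq> 0)"
    by (force simp: D_def intro: nth_fls_subdegree_nonzero)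
  have ge: "ord_ge m (S $$ (i, j))" if "i \<in> J" "j \<in> J" for i j
    unfolding ord_ge_iff m_def using fin that by (auto simp: D_def intro!: Min_le)
  define P where "P i \<longleftrightarrow> i \<in> J \<and> (\<exists>c\<in>J. fls_nth (S $$ (i, c)) m \<noteq> 0)" for i
  define r where "r = Least P"
  have "P r"
    unfolding r_def by (rule LeastI_ex) (use ex in \<open>simp add: P_def\<close>)
  define Q where "Q j \<longleftrightarrow> j \<in> J \<and> fls_nth (S $$ (r, j)) m \<noteq> 0" for j
  define c where "c = Least Q"
  have "Q c"
    unfolding c_def by (rule LeastI_ex) (use \<open>P r\<close> in \<open>auto simp: P_def Q_def\<close>)
  have less: "fls_nth (S $$ (i, j)) m = 0" if "i \<in> J" "j \<in> J" "i < r \<or> i = r \<and> j < c" for i j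
    using that not_less_Least[of i P, folded r_def] not_less_Least[of j Q, folded c_def]
    by (auto simp: P_def Q_def)
  show thesis
  proof (rule that)
    show "r \<in> J" "c \<in> J" "fls_nth (S $$ (r, c)) m \<noteq> 0"
      using \<open>P r\<close> \<open>Q c\<close> by (simp_all add: P_def Q_def)
  qed (use ge less ord_ge_Suc in blast)+
qed

lemma quadratic_root:
  fixes p q s e D :: "'a::field"
  assumes "e \<noteq> 0" "e = q + D" "p * s = q\<^sup>2 - D\<^sup>2"
  shows "p + 2 * q * (- p / e) + s * (- p / e)\<^sup>2 = 0"
    and "p * (- s / e) + q * (1 + (- s / e) * (- p / e)) + s * (- p / e) = 2 * D\<^sup>2 / e"
proof -
  have "p + 2 * q * (- p / e) + s * (- p / e)\<^sup>2 = p * (e\<^sup>2 - 2 * q * e + p * s) / e\<^sup>2"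
    using assms(1) by (simp add: divide_simps power2_eq_square) (simp add: algebra_simps)
  also have "e\<^sup>2 - 2 * q * e + p * s = 0"
    unfolding assms(2,3) by (simp add: algebra_simps power2_eq_square)
  finally show "p + 2 * q * (- p / e) + s * (- p / e)\<^sup>2 = 0"
    by simp
  have "p * (- s / e) + q * (1 + (- s / e) * (- p / e)) + s * (- p / e)
      = (q * e\<^sup>2 - 2 * (p * s) * e + q * (p * s)) / e\<^sup>2"
    using assms(1) by (simp add: divide_simps power2_eq_square) (simp add: algebra_simps)
  also have "q * e\<^sup>2 - 2 * (p * s) * e + q * (p * s) = 2 * D\<^sup>2 * e"
    unfolding assms(2,3) by (simp add: algebra_simps power2_eq_square)
  finally show "p * (- s / e) + q * (1 + (- s / e) * (- p / e)) + s * (- p / e) = 2 * D\<^sup>2 / e"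
    using assms(1) by (simp add: power2_eq_square)
qed

text \<open>A plane with basis \<open>u, v\<close> and form \<open>p = (u, u)\<close>, \<open>q = (u, v)\<close>, \<open>s = (v, v)\<close> also has a basis of
  isotropic vectors \<open>u + g v\<close> and \<open>v + f u\<close>. The two quadratic equations have the common
  discriminant \<open>q\<^sup>2 - p s\<close>, which is a square by the assumptions on the orders. Its root \<open>D\<close> is taken
  with the same leading coefficient as \<open>q\<close>, so that the denominator \<open>q + D\<close> has the order of \<open>q\<close>.\<close>

lemma isotropic_basis:
  fixes p q s :: "'k::field fls"
  assumes two: "(2::'k) \<noteq> 0" and p: "ord_ge (m + 1) p" and q: "ord_eq m q" and s: "ord_ge m s"
  obtains f g where "ord_ge 0 f" "ord_ge 1 g" "p + 2 * q * g + s * g\<^sup>2 = 0" "s + 2 * q * f + p * f\<^sup>2 = 0"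
    "p * f + q * (1 + f * g) + s * g \<noteq> 0"
proof -
  have q0: "q \<noteq> 0"
    using q by (auto simp: ord_eq_iff)
  have q2: "ord_eq (2 * m) (q\<^sup>2)"
    using ord_eq_mult[OF q q] by (simp add: power2_eq_square)
  define u where "u = 1 - p * s / q\<^sup>2"
  have "ord_ge 1 (p * s / q\<^sup>2)"
    using ord_ge_mult[OF p s] by (rule ord_ge_divide[OF _ q2]) simp
  then have "ord_ge 0 u" "fls_nth u 0 = 1"
    by (auto simp: u_def ord_ge_def)
  then obtain z where z: "z\<^sup>2 = u" "ord_ge 0 z" "fls_nth z 0 = 1"
    using unit_sqrt_exists[OF two, of u 1] by auto
  define D where "D = q * z"
  define e where "e = q + D"
  have "D\<^sup>2 = q\<^sup>2 * (1 - p * s / q\<^sup>2)"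
    by (simp add: D_def power_mult_distrib z(1) u_def)
  also have "\<dots> = q\<^sup>2 - p * s"
    using q0 by (simp add: right_diff_distrib)
  finally have ps: "p * s = q\<^sup>2 - D\<^sup>2"
    by simp
  have "ord_eq 0 (1 + z)"
    using z two by (simp add: ord_eq_def ord_ge_add)
  then have e: "ord_eq m e"
    using ord_eq_mult[OF q, of 0 "1 + z"] by (simp add: e_def D_def distrib_left)
  then have e0: "e \<noteq> 0"
    by (auto simp: ord_eq_iff)
  have D: "D \<noteq> 0"
    using q0 z(3) by (auto simp: D_def)
  show thesis
  proof (rule that[of "- s / e" "- p / e"])
    show "ord_ge 0 (- s / e)" "ord_ge 1 (- p / e)"
      using p s e by (auto intro!: ord_ge_divide[of _ _ _ e])
    note root = quadratic_root[OF e0 e_def]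
    show "p + 2 * q * (- p / e) + s * (- p / e)\<^sup>2 = 0" "s + 2 * q * (- s / e) + p * (- s / e)\<^sup>2 = 0"
      using root(1)[OF ps] root(1)[of s p] ps by (simp_all add: mult.commute)
    show "p * (- s / e) + q * (1 + (- s / e) * (- p / e)) + s * (- p / e) \<noteq> 0"
      unfolding root(2)[OF ps]
      using e0 D two by (simp add: fls_const_numeral[symmetric] del: fls_const_numeral)
  qed
qed

lemma split_off_exists:
  fixes S :: "'k::field fls mat"
  assumes two: "(2::'k) \<noteq> 0"
    and S: "S \<in> carrier_mat n n" "transpose_mat S = S" "det S \<noteq> 0"
    and I: "reduced_rows n I S" "I \<noteq> {..<n}"
  obtains b R where "b \<in> Iwahori_GL n" "R \<subseteq> {..<n}" "R \<inter> I = {}" "R \<noteq> {}"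
    "reduced_rows n (I \<union> R) (congr_mat b S)"
proof -
  define J where "J = {..<n} - I"
  have In: "I \<subseteq> {..<n}"
    using I by (simp add: reduced_rows_def)
  have Jn: "i < n" if "i \<in> J" for i
    using that by (simp add: J_def)
  have sym: "S $$ (i, j) = S $$ (j, i)" if "i < n" "j < n" for i j
    using symmetric_index[OF S(2,1)] that by blast
  have SI: "S $$ (k, y) = 0" if "y \<in> I" "k \<in> J" for k y
  proof -
    obtain c where "c \<in> I" "\<And>j. j < n \<Longrightarrow> S $$ (y, j) \<noteq> 0 \<Longrightarrow> j = c"
      using I \<open>y \<in> I\<close> unfolding reduced_rows_def by blast
    then have "S $$ (y, k) = 0"
      using that by (auto simp: J_def)
    then show ?thesis
      using sym[of k y] that In Jn by auto
  qed
  obtain i0 where i0: "i0 \<in> J"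
    using I(2) In by (auto simp: J_def)
  obtain j0 where j0: "j0 \<in> J" "S $$ (i0, j0) \<noteq> 0"
  proof -
    have "\<exists>j<n. S $$ (i0, j) \<noteq> 0"
    proof (rule ccontr)
      assume "\<not> (\<exists>j<n. S $$ (i0, j) \<noteq> 0)"
      then have "(\<Prod>i = 0..<n. S $$ (i, \<pi> i)) = 0" if "\<pi> permutes {0..<n}" for \<pi>
        using Jn[OF i0] permutes_in_image[OF that, of i0] by (intro prod_zero bexI[of _ i0]) auto
      then have "det S = 0"
        unfolding det_def'[OF S(1)] by (intro sum.neutral) simp
      then show False
        using S(3) by simp
    qed
    then obtain j where j: "j < n" "S $$ (i0, j) \<noteq> 0"
      by blast
    then have "j \<in> J"
      using SI[OF _ i0, of j] by (auto simp: J_def)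
    then show thesis
      using that j(2) by blast
  qed
  have "finite J"
    by (simp add: J_def)
  obtain r c m where rc: "r \<in> J" "c \<in> J" "fls_nth (S $$ (r, c)) m \<noteq> 0"
    and min: "\<forall>i\<in>J. \<forall>j\<in>J. ord_ge m (S $$ (i, j)) \<and>
      (i < r \<or> i = r \<and> j < c \<longrightarrow> ord_ge (m + 1) (S $$ (i, j)))"
    using pivot_exists[OF \<open>finite J\<close> i0 j0] .
  have ge: "ord_ge m (S $$ (i, j))" if "i \<in> J" "j \<in> J" for i j
    using min that by blast
  have gt: "ord_ge (m + 1) (S $$ (i, j))" if "i \<in> J" "j \<in> J" "i < r \<or> i = r \<and> j < c" for i j
    using min that by blast
  have piv: "ord_eq m (S $$ (r, c))"
    using rc ge by (simp add: ord_eq_def)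
  have gt': "ord_ge (m + 1) (S $$ (j, i))" if "i \<in> J" "j \<in> J" "i < r \<or> i = r \<and> j < c" for i j
    using gt[OF that] sym[of i j] that Jn by simp
  have "r \<le> c"
  proof (rule ccontr)
    assume "\<not> r \<le> c"
    then have "ord_ge (m + 1) (S $$ (r, c))"
      using gt'[of c r] rc by simp
    then show False
      using rc(3) by (simp add: ord_ge_def)
  qed
  have fJ: "J \<inter> I = {}" "J \<subseteq> {..<n}"
    by (auto simp: J_def)
  have JI: "j \<in> J" if "j < n" "j \<notin> I" for j
    using that by (simp add: J_def)
  show thesis
  proof (cases "r = c")
    case True
    define p where "p = S $$ (r, r)"
    have p: "ord_eq m p"
      using piv True by (simp add: p_def)
    then have p0: "p \<noteq> 0"
      by (auto simp: ord_eq_iff)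
    define X where "X i j = (if j = r then 1 else - S $$ (r, j) / p)" for i j :: nat
    have "\<exists>b\<in>Iwahori_GL n. reduced_rows n (I \<union> {r}) (congr_mat b S)"
    proof (rule split_off[OF S(1,2) I(1), of "{r}" X])
      fix i j assume "i \<in> {r}" "j < n"
      then show "ord_ge (if j < i then 1 else 0) (X i j)"
        using ge[OF rc(1), of j] gt[OF rc(1), of j] SI[OF _ rc(1), of j] JI[of j] True rc p
          ord_ge_divide[of m "S $$ (r, j)" m p 0] ord_ge_divide[of "m + 1" "S $$ (r, j)" m p 1]
        by (cases "j \<in> I") (auto simp: X_def)
    next
      fix k y assume "k \<in> {r}" "y < n" "y \<notin> {r}"
      then show "S $$ (k, y) + (\<Sum>i\<in>{r}. S $$ (k, i) * X i y) = 0"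
        using p0 by (simp add: X_def p_def)
    qed (use rc True p0 fJ SI in \<open>auto simp: X_def p_def ord_eq_def\<close>)
    then show thesis
      using that[of _ "{r}"] rc fJ by auto
  next
    case False
    then have "r < c"
      using \<open>r \<le> c\<close> by simp
    define p q s where "p = S $$ (r, r)" and "q = S $$ (r, c)" and "s = S $$ (c, c)"
    have cr: "S $$ (c, r) = q"
      using sym[of c r] rc Jn by (simp add: q_def)
    have p: "ord_ge (m + 1) p" and q: "ord_eq m q" and s: "ord_ge m s"
      using gt[of r r] ge[of c c] piv rc \<open>r < c\<close> by (simp_all add: p_def q_def s_def)
    obtain f g where f: "ord_ge 0 f" and g: "ord_ge 1 g" 
      and iso: "p + 2 * q * g + s * g\<^sup>2 = 0" "s + 2 * q * f + p * f\<^sup>2 = 0"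
      and hyp: "p * f + q * (1 + f * g) + s * g \<noteq> 0"
      using isotropic_basis[OF two p q s] .
    define d where "d = p * s - q\<^sup>2"
    have d: "ord_eq (2 * m) d"
    proof -
      have "ord_ge (2 * m + 1) (p * s)"
        using ord_ge_mult[OF p s] by (simp add: add.commute add.left_commute)
      moreover have "ord_eq (2 * m) (q\<^sup>2)"
        using ord_eq_mult[OF q q] by (simp add: power2_eq_square)
      ultimately show ?thesis
        by (auto simp: d_def ord_eq_def ord_ge_def)
    qed
    then have d0: "d \<noteq> 0"
      by (auto simp: ord_eq_iff)
    \<comment> \<open>A basis vector outside the plane is replaced by its component orthogonal to the plane.\<close>
    define X where "X i j =
      (if j = r then if i = r then 1 else g
       else if j = c then if i = r then f else 1
       else if i = r then (q * S $$ (c, j) - s * S $$ (r, j)) / d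
       else (q * S $$ (r, j) - p * S $$ (c, j)) / d)" for i j :: nat
    have "\<exists>b\<in>Iwahori_GL n. reduced_rows n (I \<union> {r, c}) (congr_mat b S)"
    proof (rule split_off[OF S(1,2) I(1), of "{r, c}" X])
      fix i j assume i: "i \<in> {r, c}" and j: "j < n"
      have q': "ord_ge m q"
        using q by (simp add: ord_eq_def)
      consider "j = r" | "j = c" | "j \<in> I" | "j \<in> J" "j \<noteq> r" "j \<noteq> c"
        using JI j by blast
      then show "ord_ge (if j < i then 1 else 0) (X i j)"
      proof cases
        case 1
        then show ?thesis
          using i f g \<open>r < c\<close> by (auto simp: X_def intro: ord_ge_mono[OF g])
      next
        case 2
        then show ?thesis
          using i f g \<open>r < c\<close> by (auto simp: X_def)
      next
        case 3
        then show ?thesis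
          using SI rc fJ by (auto simp: X_def)
      next
        case 4
        have S1: "ord_ge m (S $$ (r, j))" "ord_ge m (S $$ (c, j))"
          using ge 4 rc by auto
        have num: "ord_ge (2 * m) (q * S $$ (c, j) - s * S $$ (r, j))"
          "ord_ge (2 * m) (q * S $$ (r, j) - p * S $$ (c, j))"
          using ord_ge_mult[OF q' S1(1)] ord_ge_mult[OF q' S1(2)] ord_ge_mult[OF s S1(1)]
            ord_ge_mult[OF ord_ge_mono[OF p, of m] S1(2)] by (auto intro!: ord_ge_diff)
        have pS: "ord_ge (2 * m + 1) (p * S $$ (c, j))"
          using ord_ge_mult[OF p S1(2)] by (simp add: add.commute add.left_commute)
        have num_r: "ord_ge (2 * m + 1) (q * S $$ (c, j) - s * S $$ (r, j))" if "j < r"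
        proof -
          have S2: "ord_ge (m + 1) (S $$ (r, j))" "ord_ge (m + 1) (S $$ (c, j))"
            using gt[of r j] gt'[of j c] that 4 rc \<open>r < c\<close> by auto
          show ?thesis
            using ord_ge_mult[OF q' S2(2)] ord_ge_mult[OF s S2(1)] 
            by (auto intro!: ord_ge_diff simp: algebra_simps)
        qed
        have num_c: "ord_ge (2 * m + 1) (q * S $$ (r, j) - p * S $$ (c, j))" if "j < c"
        proof -
          have S2: "ord_ge (m + 1) (S $$ (r, j))"
            using gt[of r j] that 4 rc by auto
          show ?thesis
            using ord_ge_mult[OF q' S2] pS by (auto intro!: ord_ge_diff simp: algebra_simps)
        qed
        show ?thesis
          using i 4 num num_r num_c d False
          by (auto simp: X_def intro: ord_ge_divide[OF _ d])
      qed
    next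
      fix k y assume "k \<in> {r, c}" "y < n" "y \<notin> {r, c}"
      moreover have "a + (p * ((q * b - s * a) / d) + q * ((q * a - p * b) / d)) = 0"
        "b + (q * ((q * b - s * a) / d) + s * ((q * a - p * b) / d)) = 0" for a b
        using d0 unfolding add_divide_eq_iff times_divide_eq_right add_divide_distrib[symmetric]
        by (simp_all add: add_divide_eq_iff d_def algebra_simps power2_eq_square)
      ultimately show "S $$ (k, y) + (\<Sum>i\<in>{r, c}. S $$ (k, i) * X i y) = 0"
        using \<open>r < c\<close> by (auto simp: X_def p_def[symmetric] q_def[symmetric] s_def[symmetric] cr)
    next
      fix k assume k: "k \<in> {r, c}"
      define Q where "Q k l = (\<Sum>i\<in>{r, c}. X i k * (\<Sum>j\<in>{r, c}. S $$ (i, j) * X j l))" for k l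
      have "Q r r = p + 2 * q * g + s * g\<^sup>2" "Q c c = s + 2 * q * f + p * f\<^sup>2"
        "Q r c = p * f + q * (1 + f * g) + s * g" "Q c r = p * f + q * (1 + f * g) + s * g"
        using False by (simp_all add: Q_def X_def cr p_def[symmetric] q_def[symmetric] s_def[symmetric]
            algebra_simps power2_eq_square)
      then have Q: "Q r r = 0" "Q c c = 0" "Q r c \<noteq> 0" "Q c r \<noteq> 0"
        using iso hyp by simp_all
      show "\<exists>c'\<in>{r, c}. \<forall>l\<in>{r, c}. (\<Sum>i\<in>{r, c}. X i k * (\<Sum>j\<in>{r, c}. S $$ (i, j) * X j l)) \<noteq> 0 \<longleftrightarrow> l = c'"
        unfolding Q_def[symmetric] using k Q False by auto
    qed (use rc False fJ SI f g in \<open>auto simp: X_def ord_eq_def\<close>)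
    then show thesis
      using that[of _ "{r, c}"] rc fJ by auto
  qed
qed

text \<open>Elimination on all indices, by induction on the number of rows not yet reduced.\<close>

lemma reduce_to_monomial:
  fixes S :: "'k::field fls mat"
  assumes two: "(2::'k) \<noteq> 0"
    and S: "S \<in> carrier_mat n n" "transpose_mat S = S" "det S \<noteq> 0" "reduced_rows n I S"
  shows "\<exists>b\<in>Iwahori_GL n. reduced_rows n {..<n} (congr_mat b S)"
  using S
proof (induction "card ({..<n} - I)" arbitrary: S I rule: less_induct)
  case less
  show ?case
  proof (cases "I = {..<n}")
    case True
    have "congr_mat (1\<^sub>m n) S = S"
      using less.prems by simp
    then show ?thesis
      using less.prems True one_Iwahori_GL by metis
  next
    case False
    obtain b R where b: "b \<in> Iwahori_GL n" and R: "R \<subseteq> {..<n}" "R \<inter> I = {}" "R \<noteq> {}"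
      and red: "reduced_rows n (I \<union> R) (congr_mat b S)"
      using split_off_exists[OF two less.prems False] .
    have bc: "b \<in> carrier_mat n n"
      using b by (rule Iwahori_GL_carrier)
    have "det b \<noteq> 0"
      using Iwahori_GL_det(1)[OF b] by (auto simp: ord_eq_iff)
    then have "det (congr_mat b S) \<noteq> 0"
      using congr_mat_det[OF bc less.prems(1)] less.prems(3) by simp
    moreover have "card ({..<n} - (I \<union> R)) < card ({..<n} - I)"
      using R by (intro psubset_card_mono) auto
    ultimately obtain b' where b': "b' \<in> Iwahori_GL n"
      "reduced_rows n {..<n} (congr_mat b' (congr_mat b S))"
      using less.hyps[OF _ congr_mat_carrier[OF bc less.prems(1)]
          congr_mat_symmetric[OF bc less.prems(1,2)] _ red] by blast
    then show ?thesis
      using congr_mat_mult[OF bc Iwahori_GL_carrier[OF b'(1)] less.prems(1)] Iwahori_GL_mult[OF b b'(1)]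
      by metis
  qed
qed

section \<open>Monomial matrices supported on an involution\<close>

lemma (in comm_monoid_set) involution_pairs:
  fixes \<sigma> :: "'b::linorder \<Rightarrow> 'b"
  assumes "finite S" and inv: "\<And>r. r \<in> S \<Longrightarrow> \<sigma> r \<in> S \<and> \<sigma> (\<sigma> r) = r \<and> \<sigma> r \<noteq> r"
  shows "F g S = F (\<lambda>r. g r \<^bold>* g (\<sigma> r)) {r \<in> S. r < \<sigma> r}"
proof -
  let ?P = "{r \<in> S. r < \<sigma> r}" and ?Q = "{r \<in> S. \<sigma> r < r}"
  have "S = ?P \<union> ?Q"
    using inv by (auto simp: neq_iff)
  then have "F g S = F g (?P \<union> ?Q)"
    by simp
  also have "\<dots> = F g ?P \<^bold>* F g ?Q"
    using assms(1) by (intro union_disjoint) auto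
  also have "F g ?Q = F (\<lambda>r. g (\<sigma> r)) ?P"
    by (rule reindex_bij_witness[of _ \<sigma> \<sigma>]) (use inv in auto)
  finally show ?thesis
    by (simp add: distrib)
qed

text \<open>The sign of an involution is \<open>-1\<close> to the number of its two-cycles, stated in a form in
  which every two-cycle contributes its \<open>-1\<close> as a product of two factors.\<close>

lemma sign_involution:
  fixes e :: "'b \<Rightarrow> 'a::comm_ring_1"
  assumes "finite S" and "\<sigma> permutes S" and "\<And>r. \<sigma> (\<sigma> r) = r"
    and "\<And>r. r \<in> S \<Longrightarrow> \<sigma> r = r \<Longrightarrow> e r = 1"
    and "\<And>r. r \<in> S \<Longrightarrow> \<sigma> r \<noteq> r \<Longrightarrow> e r * e (\<sigma> r) = -1"
  shows "of_int (sign \<sigma>) * (\<Prod>r\<in>S. e r) = 1"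
  using assms(2-)
proof (induction "card {r \<in> S. \<sigma> r \<noteq> r}" arbitrary: \<sigma> e rule: less_induct)
  case less
  show ?case
  proof (cases "\<exists>a\<in>S. \<sigma> a \<noteq> a")
    case False
    then have "\<sigma> = id"
      using less.prems(1) by (auto simp: fun_eq_iff permutes_def)
    then show ?thesis
      using less.prems(3) by simp
  next
    case True
    then obtain a where a: "a \<in> S" "\<sigma> a \<noteq> a"
      by blast
    define b where "b = \<sigma> a"
    have b: "b \<in> S" "b \<noteq> a" "\<sigma> b = a"
      using a less.prems(1,2) by (auto simp: b_def permutes_in_image)
    define \<sigma>' where "\<sigma>' = \<sigma> \<circ> Transposition.transpose a b"
    define e' where "e' = e(a := 1, b := 1)"
    have \<sigma>': "\<sigma>' r = (if r = a \<or> r = b then r else \<sigma> r)" for r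
      using b by (auto simp: \<sigma>'_def Transposition.transpose_def b_def)
    have perm: "\<sigma>' permutes S"
      unfolding \<sigma>'_def using a b less.prems(1) by (intro permutes_compose permutes_swap_id)
    have mem: "\<sigma> r \<noteq> a" "\<sigma> r \<noteq> b" if "r \<noteq> a" "r \<noteq> b" for r
      using that less.prems(2) b by (metis b_def)+
    have "{r \<in> S. \<sigma>' r \<noteq> r} \<subset> {r \<in> S. \<sigma> r \<noteq> r}"
      using a \<sigma>' by auto
    then have "card {r \<in> S. \<sigma>' r \<noteq> r} < card {r \<in> S. \<sigma> r \<noteq> r}"
      using assms(1) by (intro psubset_card_mono) auto
    then have IH: "of_int (sign \<sigma>') * (\<Prod>r\<in>S. e' r) = 1"
    proof (rule less.hyps[OF _ perm])
      show "\<sigma>' (\<sigma>' r) = r" for r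
        using mem[of r] less.prems(2) by (auto simp: \<sigma>')
    qed (use mem less.prems(3,4) in \<open>auto simp: \<sigma>' e'_def split: if_splits\<close>)
    have "\<sigma> = \<sigma>' \<circ> Transposition.transpose a b"
      by (simp add: \<sigma>'_def comp_assoc)
    then have sgn: "sign \<sigma> = - sign \<sigma>'"
      using perm assms(1) b(2)
      by (metis mult_minus1_right permutation_permutes permutation_swap_id sign_compose sign_swap_id)
    have split: "(\<Prod>r\<in>S. f r) = f a * f b * (\<Prod>r\<in>S - {a} - {b}. f r)" for f :: "_ \<Rightarrow> 'a"
      using assms(1) a b by (simp add: prod.remove[of S a] prod.remove[of "S - {a}" b] mult.assoc)
    have "(\<Prod>r\<in>S - {a} - {b}. e' r) = (\<Prod>r\<in>S - {a} - {b}. e r)"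
      by (intro prod.cong) (auto simp: e'_def)
    moreover have "e a * e b = -1"
      using less.prems(4)[OF a] by (simp add: b_def)
    ultimately have "(\<Prod>r\<in>S. e r) = - (\<Prod>r\<in>S. e' r)"
      unfolding split[of e] split[of e'] using b(2) by (simp add: e'_def)
    then show ?thesis
      using IH sgn by simp
  qed
qed

text \<open>A symmetric monomial matrix has nonzero entries exactly at the positions \<open>(r, \<sigma> r)\<close> for an
  involution \<open>\<sigma>\<close> of the indices; outside the range of indices, \<open>\<sigma>\<close> is the identity.\<close>

definition supported_on :: "nat \<Rightarrow> (nat \<Rightarrow> nat) \<Rightarrow> 'a::zero mat \<Rightarrow> bool" where
  "supported_on n \<sigma> W \<longleftrightarrow> \<sigma> permutes {0..<n} \<and> (\<forall>r. \<sigma> (\<sigma> r) = r) \<and>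
     (\<forall>r<n. \<forall>j<n. W $$ (r, j) \<noteq> 0 \<longleftrightarrow> j = \<sigma> r)"

lemma supported_onD:
  assumes "supported_on n \<sigma> W"
  shows "\<sigma> permutes {0..<n}" "\<sigma> (\<sigma> r) = r" "r < n \<Longrightarrow> \<sigma> r < n"
    "r < n \<Longrightarrow> W $$ (r, \<sigma> r) \<noteq> 0" "r < n \<Longrightarrow> j < n \<Longrightarrow> j \<noteq> \<sigma> r \<Longrightarrow> W $$ (r, j) = 0"
proof -
  show "\<sigma> permutes {0..<n}" "\<sigma> (\<sigma> r) = r"
    using assms by (auto simp: supported_on_def)
  then show *: "r < n \<Longrightarrow> \<sigma> r < n"
    using permutes_in_image[of \<sigma> "{0..<n}" r] by simp
  show "r < n \<Longrightarrow> W $$ (r, \<sigma> r) \<noteq> 0" "r < n \<Longrightarrow> j < n \<Longrightarrow> j \<noteq> \<sigma> r \<Longrightarrow> W $$ (r, j) = 0"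
    using assms * unfolding supported_on_def by blast+
qed

lemma reduced_rows_supported_on:
  fixes W :: "'a::comm_ring_1 mat"
  assumes "W \<in> carrier_mat n n" "transpose_mat W = W" "reduced_rows n {..<n} W"
  obtains \<sigma> where "supported_on n \<sigma> W"
proof -
  have "\<forall>r\<in>{..<n}. \<exists>c. c < n \<and> (\<forall>j<n. W $$ (r, j) \<noteq> 0 \<longleftrightarrow> j = c)"
    using assms(3) unfolding reduced_rows_def by blast
  then obtain c where c: "\<And>r. r < n \<Longrightarrow> c r < n"
    "\<And>r j. r < n \<Longrightarrow> j < n \<Longrightarrow> W $$ (r, j) \<noteq> 0 \<longleftrightarrow> j = c r"
    by (metis lessThan_iff)
  define \<sigma> where "\<sigma> r = (if r < n then c r else r)" for r
  have inv: "\<sigma> (\<sigma> r) = r" for r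
  proof (cases "r < n")
    case True
    then have "W $$ (c r, r) \<noteq> 0"
      using c(2)[of r "c r"] c(1)[of r] symmetric_index[OF assms(2,1), of r "c r"] by simp
    then show ?thesis
      using True c(2)[of "c r" r] c(1)[of r] by (simp add: \<sigma>_def)
  qed (simp add: \<sigma>_def)
  have "\<sigma> permutes {0..<n}"
    unfolding permutes_def
  proof (intro conjI allI impI)
    show "\<exists>!x. \<sigma> x = y" for y
      by (rule ex1I[of _ "\<sigma> y"]) (use inv in auto)
  qed (simp add: \<sigma>_def)
  then have "supported_on n \<sigma> W"
    using inv c by (auto simp: supported_on_def \<sigma>_def)
  then show thesis
    by (rule that)
qed

lemma supported_on_monomial_mat:
  assumes "W \<in> carrier_mat n n" "supported_on n \<sigma> W"
  shows "monomial_mat n W"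
proof -
  note \<sigma> = supported_onD[OF assms(2)]
  have iff: "W $$ (r, j) \<noteq> 0 \<longleftrightarrow> j = \<sigma> r" if "r < n" "j < n" for r j
    using assms(2) that by (auto simp: supported_on_def)
  have "\<exists>!c. c < n \<and> W $$ (r, c) \<noteq> 0" if "r < n" for r
    using iff[OF that] \<sigma>(3)[OF that] by (intro ex1I[of _ "\<sigma> r"]) auto
  moreover have "\<exists>!r. r < n \<and> W $$ (r, c) \<noteq> 0" if "c < n" for c
    using iff[OF _ that] \<sigma>(3)[OF that] \<sigma>(2) by (intro ex1I[of _ "\<sigma> c"]) auto
  ultimately show ?thesis
    using assms(1) by (simp add: monomial_mat_def)
qed

lemma monomial_mat_reduced_rows: "monomial_mat n W \<Longrightarrow> reduced_rows n {..<n} W"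
  unfolding reduced_rows_def
proof (intro conjI ballI)
  fix r assume "monomial_mat n W" "r \<in> {..<n}"
  then obtain c where c: "c < n \<and> W $$ (r, c) \<noteq> 0" "\<forall>j. j < n \<and> W $$ (r, j) \<noteq> 0 \<longrightarrow> j = c"
    unfolding monomial_mat_def by (metis lessThan_iff)
  have "W $$ (r, j) \<noteq> 0 \<longleftrightarrow> j = c" if "j < n" for j
    using c that by blast
  then show "\<exists>c\<in>{..<n}. \<forall>j<n. W $$ (r, j) \<noteq> 0 \<longleftrightarrow> j = c"
    using c(1) by blast
qed simp

lemma det_supported_on:
  fixes W :: "'a::comm_ring_1 mat"
  assumes "W \<in> carrier_mat n n" "supported_on n \<sigma> W"
  shows "det W = of_int (sign \<sigma>) * (\<Prod>r = 0..<n. W $$ (r, \<sigma> r))"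
proof -
  note \<sigma> = supported_onD[OF assms(2)]
  have zero: "(\<Prod>r = 0..<n. W $$ (r, \<pi> r)) = 0" if \<pi>: "\<pi> permutes {0..<n}" "\<pi> \<noteq> \<sigma>" for \<pi>
  proof -
    obtain r where r: "\<pi> r \<noteq> \<sigma> r"
      using \<pi>(2) by (auto simp: fun_eq_iff)
    then have "r < n"
      using \<pi>(1) \<sigma>(1) by (metis atLeastLessThan_iff permutes_not_in zero_le)
    then have "W $$ (r, \<pi> r) = 0"
      using \<sigma>(5) r permutes_in_image[OF \<pi>(1), of r] by auto
    then show ?thesis
      using \<open>r < n\<close> by (intro prod_zero) auto
  qed
  have "det W = (\<Sum>\<pi>\<in>{\<pi>. \<pi> permutes {0..<n}}. 
      if \<pi> = \<sigma> then of_int (sign \<sigma>) * (\<Prod>r = 0..<n. W $$ (r, \<sigma> r)) else 0)"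
    unfolding det_def'[OF assms(1)] using zero by (intro sum.cong) auto
  also have "\<dots> = of_int (sign \<sigma>) * (\<Prod>r = 0..<n. W $$ (r, \<sigma> r))"
    using \<sigma>(1) finite_permutations[of "{0..<n}"] by simp
  finally show ?thesis .
qed

lemma fls_X_intpow_add: "fls_X_intpow a * fls_X_intpow b = (fls_X_intpow (a + b) :: 'k::comm_ring_1 fls)"
  by (simp add: fls_times_both_shifted_simp add.commute)

lemma prod_fls_X_intpow:
  "(\<Prod>r\<in>A. fls_X_intpow (a r)) = (fls_X_intpow (\<Sum>r\<in>A. a r) :: 'k::comm_ring_1 fls)"
  by (induction A rule: infinite_finite_induct) (simp_all only: prod.infinite sum.infinite prod.empty
      sum.empty prod.insert sum.insert fls_X_intpow_add not_False_eq_True minus_zero fls_shift_0)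

text \<open>The leading coefficient in row \<open>r\<close> of a normalised monomial matrix with involution \<open>\<sigma>\<close>; \<open>\<epsilon>\<close> is
  the sign occurring in the first row and column. That \<open>\<epsilon> = 1\<close> if \<open>\<sigma>\<close> has a fixed point is required
  separately.\<close>

definition unit_coeff :: "'k::field \<Rightarrow> (nat \<Rightarrow> nat) \<Rightarrow> 'k \<Rightarrow> nat \<Rightarrow> 'k" where
  "unit_coeff \<iota> \<sigma> \<epsilon> r = (if \<sigma> r = r then 1 else if r = 0 \<or> \<sigma> r = 0 then \<epsilon> * \<iota> else \<iota>)"

lemma det_unit_coeff:
  fixes w :: "'k::field fls mat"
  assumes w: "w \<in> carrier_mat n n" "supported_on n \<sigma> w" and "\<iota>\<^sup>2 = -1" "\<epsilon>\<^sup>2 = 1"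
    and entries: "\<And>r. r < n \<Longrightarrow> w $$ (r, \<sigma> r) = fls_const (unit_coeff \<iota> \<sigma> \<epsilon> r) * fls_X_intpow (a r)"
  shows "det w = fls_X_intpow (\<Sum>r = 0..<n. a r)"
proof -
  note \<sigma> = supported_onD[OF w(2)]
  have "of_int (sign \<sigma>) * (\<Prod>r\<in>{0..<n}. fls_const (unit_coeff \<iota> \<sigma> \<epsilon> r)) = 1"
  proof (rule sign_involution[OF _ \<sigma>(1,2)])
    fix r assume "\<sigma> r \<noteq> r"
    have "unit_coeff \<iota> \<sigma> \<epsilon> r * unit_coeff \<iota> \<sigma> \<epsilon> (\<sigma> r) = -1"
      using \<open>\<sigma> r \<noteq> r\<close> \<sigma>(2) assms(3,4) by (auto simp: unit_coeff_def power2_eq_square algebra_simps)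
    then show "fls_const (unit_coeff \<iota> \<sigma> \<epsilon> r) * fls_const (unit_coeff \<iota> \<sigma> \<epsilon> (\<sigma> r)) = -1"
      by simp
  qed (simp_all add: unit_coeff_def)
  then show ?thesis
    unfolding det_supported_on[OF w] using entries
    by (simp add: prod.distrib prod_fls_X_intpow mult.assoc[symmetric])
qed

text \<open>The normalised monomial matrices, parametrised by an involution, exponents and a sign.\<close>

lemma iSymAPM_iff:
  fixes w :: "'k::field fls mat"
  assumes "\<iota>\<^sup>2 = -1" 
  shows "w \<in> iSymAPM \<iota> n \<longleftrightarrow> w \<in> carrier_mat n n \<and> det w = 1 \<and> transpose_mat w = w \<and>
    (\<exists>\<sigma> \<epsilon> a. supported_on n \<sigma> w \<and> \<epsilon> \<in> {1, -1} \<and> ((\<exists>r<n. \<sigma> r = r) \<longrightarrow> \<epsilon> = 1) \<and>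
      (\<forall>r<n. w $$ (r, \<sigma> r) = fls_const (unit_coeff \<iota> \<sigma> \<epsilon> r) * fls_X_intpow (a r)))"
  (is "_ \<longleftrightarrow> ?R")
proof
  assume w: "w \<in> iSymAPM \<iota> n"
  then have c: "w \<in> carrier_mat n n" "det w = 1" "transpose_mat w = w" "monomial_mat n w"
    by (auto simp: iSymAPM_def SL_def)
  obtain \<sigma> where supp: "supported_on n \<sigma> w"
    using reduced_rows_supported_on[OF c(1,3) monomial_mat_reduced_rows[OF c(4)]] .
  note \<sigma> = supported_onD[OF supp]
  have fix_iff: "(\<exists>r<n. w $$ (r, r) \<noteq> 0) \<longleftrightarrow> (\<exists>r<n. \<sigma> r = r)"
    using \<sigma>(4,5) by metis
  have "\<exists>\<epsilon>. \<epsilon> \<in> {1, -1} \<and> ((\<exists>r<n. \<sigma> r = r) \<longrightarrow> \<epsilon> = 1) \<and>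
    (\<forall>r<n. \<exists>a. w $$ (r, \<sigma> r) = fls_const (unit_coeff \<iota> \<sigma> \<epsilon> r) * fls_X_intpow a)"
  proof (cases "\<exists>r<n. \<sigma> r = r")
    case True
    have "\<exists>a. w $$ (r, \<sigma> r) = fls_const (unit_coeff \<iota> \<sigma> 1 r) * fls_X_intpow a" if "r < n" for r
      using w True fix_iff \<sigma>(3,4)[OF that] that by (cases "\<sigma> r = r") (auto simp: iSymAPM_def unit_coeff_def)
    then show ?thesis
      by (intro exI[of _ 1]) auto
  next
    case False
    have sym: "w $$ (\<sigma> 0, 0) = w $$ (0, \<sigma> 0)" if "0 < n"
      using symmetric_index[OF c(3,1)] \<sigma>(3) that by blast
    have first: "\<exists>\<epsilon>\<in>{1, -1}. \<exists>a. w $$ (0, \<sigma> 0) = fls_const (\<epsilon> * \<iota>) * fls_X_intpow a" if n0: "0 < n"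
    proof -
      have "\<forall>r<n. \<forall>c<n. (r = 0 \<or> c = 0) \<and> w $$ (r, c) \<noteq> 0 \<longrightarrow>
           (\<exists>a. w $$ (r, c) = fls_const \<iota> * fls_X_intpow a \<or>
                w $$ (r, c) = - fls_const \<iota> * fls_X_intpow a)"
        using w False fix_iff unfolding iSymAPM_def by blast
      then obtain a where "w $$ (0, \<sigma> 0) = fls_const \<iota> * fls_X_intpow a \<or>
                w $$ (0, \<sigma> 0) = - fls_const \<iota> * fls_X_intpow a"
        using \<sigma>(3,4)[OF n0] n0 by blast
      then show ?thesis
        by auto
    qed
    obtain \<epsilon> where \<epsilon>: "\<epsilon> \<in> {1, -1}" "0 < n \<Longrightarrow> \<exists>a. w $$ (0, \<sigma> 0) = fls_const (\<epsilon> * \<iota>) * fls_X_intpow a"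
      using first by (cases "0 < n") (blast, force)
    have "\<exists>a. w $$ (r, \<sigma> r) = fls_const (unit_coeff \<iota> \<sigma> \<epsilon> r) * fls_X_intpow a" if "r < n" for r
    proof -
      consider "r = 0" | "\<sigma> r = 0" "r \<noteq> 0" | "r \<noteq> 0" "\<sigma> r \<noteq> 0"
        by blast
      then show ?thesis
      proof cases
        case 1
        then show ?thesis
          using \<epsilon>(2) False that by (auto simp: unit_coeff_def)
      next
        case 2
        then have "r = \<sigma> 0"
          using \<sigma>(2)[of r] by simp
        then show ?thesis
          using \<epsilon>(2) sym False that 2 by (auto simp: unit_coeff_def)
      next
        case 3
        then show ?thesis
          using w False fix_iff \<sigma>(3,4)[OF that] that by (auto simp: iSymAPM_def unit_coeff_def)
      qed
    qed
    then show ?thesis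
      using \<epsilon>(1) False by blast
  qed
  then obtain \<epsilon> a where "\<epsilon> \<in> {1, -1}" "(\<exists>r<n. \<sigma> r = r) \<longrightarrow> \<epsilon> = 1"
    "\<forall>r<n. w $$ (r, \<sigma> r) = fls_const (unit_coeff \<iota> \<sigma> \<epsilon> r) * fls_X_intpow (a r)"
    by metis
  then show ?R
    using c supp by blast
next
  assume R: ?R
  then obtain \<sigma> \<epsilon> a where supp: "supported_on n \<sigma> w" and \<epsilon>: "\<epsilon> \<in> {1, -1}" "(\<exists>r<n. \<sigma> r = r) \<longrightarrow> \<epsilon> = 1"
    and w: "\<And>r. r < n \<Longrightarrow> w $$ (r, \<sigma> r) = fls_const (unit_coeff \<iota> \<sigma> \<epsilon> r) * fls_X_intpow (a r)"
    by blast
  note \<sigma> = supported_onD[OF supp]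
  have c: "w \<in> carrier_mat n n" "det w = 1" "transpose_mat w = w"
    using R by blast+
  have nz: "j = \<sigma> r" if "w $$ (r, j) \<noteq> 0" "r < n" "j < n" for r j
    using \<sigma>(5) that by blast
  have diag: "\<exists>a. w $$ (r, r) = fls_X_intpow a" if "r < n" "w $$ (r, r) \<noteq> 0" for r
    using w[OF that(1)] nz[OF that(2,1,1)] by (auto simp: unit_coeff_def)
  have off: "\<exists>a. w $$ (r, j) = fls_const (if r = 0 \<or> j = 0 then \<epsilon> * \<iota> else \<iota>) * fls_X_intpow a"
    if "r < n" "j < n" "r \<noteq> j" "w $$ (r, j) \<noteq> 0" for r j
    using w[OF that(1)] nz[OF that(4,1,2)] that(3) by (auto simp: unit_coeff_def)
  have fixp: "\<epsilon> = 1" if "\<exists>r<n. w $$ (r, r) \<noteq> 0"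
    using that \<epsilon>(2) nz by metis
  have "(\<exists>r<n. w $$ (r, r) \<noteq> 0) \<longrightarrow>
        (\<forall>r<n. w $$ (r, r) \<noteq> 0 \<longrightarrow> (\<exists>a. w $$ (r, r) = fls_X_intpow a)) \<and>
        (\<forall>r<n. \<forall>c<n. r \<noteq> c \<and> w $$ (r, c) \<noteq> 0 \<longrightarrow>
           (\<exists>a. w $$ (r, c) = fls_const \<iota> * fls_X_intpow a))"
  proof (intro impI conjI allI)
    fix r j assume "\<exists>r<n. w $$ (r, r) \<noteq> 0" "r < n" "j < n" "r \<noteq> j \<and> w $$ (r, j) \<noteq> 0"
    then show "\<exists>a. w $$ (r, j) = fls_const \<iota> * fls_X_intpow a"
      using off[of r j] fixp by auto
  next
    fix r assume "r < n" "w $$ (r, r) \<noteq> 0"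
    then show "\<exists>a. w $$ (r, r) = fls_X_intpow a"
      by (rule diag)
  qed
  moreover have "\<not> (\<exists>r<n. w $$ (r, r) \<noteq> 0) \<longrightarrow>
        (\<forall>r<n. \<forall>c<n. (r = 0 \<or> c = 0) \<and> w $$ (r, c) \<noteq> 0 \<longrightarrow>
           (\<exists>a. w $$ (r, c) = fls_const \<iota> * fls_X_intpow a \<or>
                w $$ (r, c) = - fls_const \<iota> * fls_X_intpow a)) \<and>
        (\<forall>r<n. \<forall>c<n. r \<noteq> 0 \<and> c \<noteq> 0 \<and> w $$ (r, c) \<noteq> 0 \<longrightarrow>
           (\<exists>a. w $$ (r, c) = fls_const \<iota> * fls_X_intpow a))"
  proof (intro impI conjI allI)
    fix r j assume *: "\<not> (\<exists>r<n. w $$ (r, r) \<noteq> 0)" "r < n" "j < n" "(r = 0 \<or> j = 0) \<and> w $$ (r, j) \<noteq> 0"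
    then have "r \<noteq> j"
      by blast
    then show "\<exists>a. w $$ (r, j) = fls_const \<iota> * fls_X_intpow a \<or> w $$ (r, j) = - fls_const \<iota> * fls_X_intpow a"
      using off[of r j] * \<epsilon>(1) by auto
  next
    fix r j assume *: "\<not> (\<exists>r<n. w $$ (r, r) \<noteq> 0)" "r < n" "j < n" "r \<noteq> 0 \<and> j \<noteq> 0 \<and> w $$ (r, j) \<noteq> 0"
    then have "r \<noteq> j"
      by blast
    then show "\<exists>a. w $$ (r, j) = fls_const \<iota> * fls_X_intpow a"
      using off[of r j] * by simp
  qed
  moreover have "w \<in> carrier (SL n)" "monomial_mat n w"
    using c supported_on_monomial_mat[OF c(1) supp] by (simp_all add: SL_def)
  ultimately show "w \<in> iSymAPM \<iota> n"
    unfolding iSymAPM_def using c(3) by blast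
qed

section \<open>Normalisation by units\<close>

lemma mat_diag_Iwahori_GL:
  assumes "\<And>i. i < n \<Longrightarrow> ord_eq 0 (d i)"
  shows "mat_diag n d \<in> Iwahori_GL n"
  using assms by (auto simp: Iwahori_GL_def mat_diag_def ord_eq_def)

lemma congr_mat_diag:
  assumes "W \<in> carrier_mat n n" "i < n" "j < n"
  shows "congr_mat (mat_diag n d) W $$ (i, j) = d i * W $$ (i, j) * d j"
proof -
  have "transpose_mat (mat_diag n d) = mat_diag n d"
    by (auto simp: mat_diag_def)
  then have "congr_mat (mat_diag n d) W = mat n n (\<lambda>(i, j). d i * W $$ (i, j)) * mat_diag n d"
    using mat_diag_mult_left[OF assms(1), of d] by simp
  then show ?thesis
    using assms(2,3) mat_diag_mult_right[of "mat n n (\<lambda>(i, j). d i * W $$ (i, j))" n n d] by simp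
qed

lemma supported_on_congr_mat_diag:
  fixes W :: "'a::field mat"
  assumes "W \<in> carrier_mat n n" "supported_on n \<sigma> W" "\<And>i. i < n \<Longrightarrow> d i \<noteq> 0"
  shows "supported_on n \<sigma> (congr_mat (mat_diag n d) W)"
  using assms(2,3) unfolding supported_on_def by (auto simp del: index_mult_mat simp: congr_mat_diag[OF assms(1)])

text \<open>Scaling the basis vectors by units of \<open>A\<close> brings every nonzero entry to the required form.\<close>

lemma unit_scaling_exists:
  fixes W :: "'k::field fls mat"
  assumes two: "(2::'k) \<noteq> 0" and sqrt_ex: "\<forall>x::'k. \<exists>y. y\<^sup>2 = x" and i0: "\<iota> \<noteq> 0"
    and W: "W \<in> carrier_mat n n" "transpose_mat W = W" "supported_on n \<sigma> W"
  obtains d a where "\<And>r. r < n \<Longrightarrow> ord_eq 0 (d r)"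
    "\<And>r. r < n \<Longrightarrow> d r * W $$ (r, \<sigma> r) * d (\<sigma> r) = fls_const (unit_coeff \<iota> \<sigma> 1 r) * fls_X_intpow (a r)"
proof -
  note \<sigma> = supported_onD[OF W(3)]
  define a where "a r = fls_subdegree (W $$ (r, \<sigma> r))" for r
  have W0: "W $$ (r, \<sigma> r) \<noteq> 0" "ord_eq (a r) (W $$ (r, \<sigma> r))" if "r < n" for r
    using \<sigma>(4)[OF that] by (auto simp: a_def intro: ord_eq_subdegree)
  have sym: "W $$ (\<sigma> r, r) = W $$ (r, \<sigma> r)" if "r < n" for r
    using symmetric_index[OF W(2,1)] \<sigma>(3) that by blast
  have scale: "\<exists>z. ord_eq 0 z \<and> z * u * z = fls_X_intpow k" if u: "ord_eq k u" for u :: "'k fls" and k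
  proof -
    define v where "v = u / fls_X_intpow k"
    have v: "ord_eq 0 v" "u = v * fls_X_intpow k"
      using ord_eq_divide[OF u, of k "fls_X_intpow k" 0] by (simp_all add: v_def)
    obtain y where y: "y\<^sup>2 = fls_nth v 0"
      using sqrt_ex by blast
    have "ord_ge 0 v" "fls_nth v 0 \<noteq> 0"
      using v(1) by (simp_all add: ord_eq_def)
    then have "y \<noteq> 0"
      using y by auto
    then obtain s where s: "s\<^sup>2 = v" "ord_ge 0 s" "fls_nth s 0 = y" "y \<noteq> 0"
      using unit_sqrt_exists[OF two \<open>ord_ge 0 v\<close> y] by blast
    then have "ord_eq 0 s" "s \<noteq> 0"
      by (auto simp: ord_eq_def)
    then show ?thesis
      using ord_eq_inverse[of 0 s] v(2) s(1)
      by (intro exI[of _ "inverse s"]) (auto simp: power2_eq_square field_simps)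
  qed
  define z where "z u k = (SOME z. ord_eq 0 z \<and> z * u * z = (fls_X_intpow k :: 'k fls))" for u k
  have z: "ord_eq 0 (z u k)" "z u k * u * z u k = fls_X_intpow k" if "ord_eq k u" for u k
    using someI_ex[OF scale[OF that]] unfolding z_def by blast+
  \<comment> \<open>Of the two vectors of a hyperbolic pair, only the one with the larger index is scaled.\<close>
  define d where "d r = (if \<sigma> r = r then z (W $$ (r, r)) (a r) else if r < \<sigma> r then 1
    else fls_const \<iota> * fls_X_intpow (a r) / W $$ (r, \<sigma> r))" for r
  have "ord_eq 0 (d r)" if "r < n" for r
  proof -
    have "ord_eq (0 + a r) (fls_const \<iota> * fls_X_intpow (a r))"
      using i0 by (intro ord_eq_mult) simp_all
    then have "ord_eq 0 (fls_const \<iota> * fls_X_intpow (a r) / W $$ (r, \<sigma> r))"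
      using W0(2)[OF that] by (intro ord_eq_divide) auto
    moreover have "ord_eq 0 (1 :: 'k fls)"
      by (simp add: ord_eq_def)
    ultimately show ?thesis
      using W0(2)[OF that] z(1) by (auto simp: d_def)
  qed
  moreover have "d r * W $$ (r, \<sigma> r) * d (\<sigma> r) = fls_const (unit_coeff \<iota> \<sigma> 1 r) * fls_X_intpow (a r)" 
    if "r < n" for r
  proof -
    have "a (\<sigma> r) = a r"
      using sym[OF that] \<sigma>(2) by (simp add: a_def)
    consider "\<sigma> r = r" | "r < \<sigma> r" | "\<sigma> r < r"
      by (meson linorder_neqE_nat)
    then show ?thesis
    proof cases
      case 1
      then show ?thesis
        using z(2)[OF W0(2)[OF that]] by (simp add: d_def unit_coeff_def)
    next
      case 2
      then show ?thesis
        using \<sigma>(2) sym[OF that] W0(1)[OF that] \<open>a (\<sigma> r) = a r\<close> by (simp add: d_def unit_coeff_def)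
    next
      case 3
      then show ?thesis
        using \<sigma>(2) W0(1)[OF that] by (simp add: d_def unit_coeff_def)
    qed
  qed
  ultimately show thesis
    using that by blast
qed

lemma iSymAPM_representative:
  fixes S :: "'k::field fls mat"
  assumes two: "(2::'k) \<noteq> 0" and sqrt_ex: "\<forall>x::'k. \<exists>y. y\<^sup>2 = x" and i_sq: "\<iota>\<^sup>2 = -1" and n: "0 < n"
    and S: "S \<in> carrier_mat n n" "transpose_mat S = S" "det S = 1"
  shows "\<exists>b\<in>Iwahori n. congr_mat b S \<in> iSymAPM \<iota> n"
proof -
  have i0: "\<iota> \<noteq> 0"
    using i_sq by auto
  have "reduced_rows n {} S"
    by (simp add: reduced_rows_def)
  then obtain b where b: "b \<in> Iwahori_GL n" and red: "reduced_rows n {..<n} (congr_mat b S)"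
    using reduce_to_monomial[OF two S(1,2)] S(3) by auto
  define W where "W = congr_mat b S"
  have bc: "b \<in> carrier_mat n n"
    using b by (rule Iwahori_GL_carrier)
  have W: "W \<in> carrier_mat n n" "transpose_mat W = W"
    unfolding W_def using congr_mat_carrier[OF bc S(1)] congr_mat_symmetric[OF bc S(1,2)] by blast+
  obtain \<sigma> where supp: "supported_on n \<sigma> W"
    using reduced_rows_supported_on[OF W red[folded W_def]] .
  note \<sigma> = supported_onD[OF supp]
  obtain d a where d: "\<And>r. r < n \<Longrightarrow> ord_eq 0 (d r)"
    "\<And>r. r < n \<Longrightarrow> d r * W $$ (r, \<sigma> r) * d (\<sigma> r) = fls_const (unit_coeff \<iota> \<sigma> 1 r) * fls_X_intpow (a r)"
    using unit_scaling_exists[OF two sqrt_ex i0 W supp] by metis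
  have d0: "d r \<noteq> 0" if "r < n" for r
    using d(1)[OF that] by (auto simp: ord_eq_iff)
  define w where "w = congr_mat (mat_diag n d) W"
  define b1 where "b1 = b * mat_diag n d"
  have b1: "b1 \<in> Iwahori_GL n"
    unfolding b1_def by (intro Iwahori_GL_mult b mat_diag_Iwahori_GL d(1))
  have b1c: "b1 \<in> carrier_mat n n"
    using b1 by (rule Iwahori_GL_carrier)
  have w_eq: "w = congr_mat b1 S"
    unfolding w_def W_def b1_def using congr_mat_mult[OF bc _ S(1)] by simp
  have wc: "w \<in> carrier_mat n n"
    unfolding w_eq by (rule congr_mat_carrier[OF b1c S(1)])
  have suppw: "supported_on n \<sigma> w"
    unfolding w_def by (rule supported_on_congr_mat_diag[OF W(1) supp d0])
  have entries: "w $$ (r, \<sigma> r) = fls_const (unit_coeff \<iota> \<sigma> 1 r) * fls_X_intpow (a r)" if "r < n" for r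
    unfolding w_def congr_mat_diag[OF W(1) that \<sigma>(3)[OF that]] by (rule d(2)[OF that])
  define \<delta> where "\<delta> = det b1"
  have \<delta>: "ord_eq 0 \<delta>"
    unfolding \<delta>_def by (rule Iwahori_GL_det(1)[OF b1])
  \<comment> \<open>The determinant of the normalised matrix is a power of \<open>t\<close> and the square of a unit, hence 1.\<close>
  have "\<delta>\<^sup>2 = fls_X_intpow (\<Sum>r = 0..<n. a r)"
    using det_unit_coeff[OF wc suppw i_sq _ entries] congr_mat_det[OF b1c S(1)] S(3)
    by (simp add: w_eq \<delta>_def)
  moreover have "ord_eq 0 (\<delta>\<^sup>2)"
    using ord_eq_mult[OF \<delta> \<delta>] by (simp add: power2_eq_square)
  ultimately have "\<delta>\<^sup>2 = 1"
    by (metis fls_shift_0 minus_zero ord_eq_X_intpow)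
  then have "\<delta> = 1 \<or> \<delta> = -1"
    by (simp add: power2_eq_1_iff)
  then obtain \<epsilon> where \<epsilon>: "\<epsilon> \<in> {1, -1}" "\<delta> = fls_const \<epsilon>"
    by (metis fls_const_1 fls_const_uminus insertCI)
  \<comment> \<open>A determinant \<open>-1\<close> is corrected at a fixed point if there is one, where this does not
    change the matrix, and otherwise at the first index, which produces the sign.\<close>
  define k where "k = (if \<exists>r<n. \<sigma> r = r then SOME r. r < n \<and> \<sigma> r = r else 0)"
  have k: "k < n" "(\<exists>r<n. \<sigma> r = r) \<Longrightarrow> \<sigma> k = k" "\<not> (\<exists>r<n. \<sigma> r = r) \<Longrightarrow> k = 0"
    using n someI_ex[of "\<lambda>r. r < n \<and> \<sigma> r = r"] by (auto simp: k_def)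
  define f where "f r = (if r = k then \<delta> else 1)" for r
  define b2 where "b2 = b1 * mat_diag n f"
  have f: "ord_eq 0 (f r)" for r
    using \<delta> by (simp add: f_def ord_eq_def)
  have b2G: "b2 \<in> Iwahori_GL n"
    unfolding b2_def by (intro Iwahori_GL_mult b1 mat_diag_Iwahori_GL f)
  have "det (mat_diag n f) = (\<Prod>r<n. f r)"
    by (subst det_upper_triangular[of _ n])
      (auto simp: mat_diag_def prod_list_diag_prod atLeast0LessThan)
  also have "\<dots> = \<delta>"
    using k(1) by (simp add: f_def)
  finally have "det b2 = 1"
    using det_mult[OF b1c, of "mat_diag n f"] \<open>\<delta>\<^sup>2 = 1\<close> by (simp add: b2_def \<delta>_def power2_eq_square)
  then have b2: "b2 \<in> Iwahori n"
    using b2G by (simp add: Iwahori_iff)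
  have b2c: "b2 \<in> carrier_mat n n"
    using b2G by (rule Iwahori_GL_carrier)
  define w' where "w' = congr_mat b2 S"
  have w': "w' = congr_mat (mat_diag n f) w"
    unfolding w'_def w_eq b2_def using congr_mat_mult[OF b1c _ S(1)] by simp
  have supp': "supported_on n \<sigma> w'"
    unfolding w' using f by (intro supported_on_congr_mat_diag[OF wc suppw]) (auto simp: ord_eq_iff)
  define \<epsilon>' where "\<epsilon>' = (if \<exists>r<n. \<sigma> r = r then 1 else \<epsilon>)"
  have entries': "w' $$ (r, \<sigma> r) = fls_const (unit_coeff \<iota> \<sigma> \<epsilon>' r) * fls_X_intpow (a r)" if "r < n" for r
  proof -
    have e: "w' $$ (r, \<sigma> r) = f r * w $$ (r, \<sigma> r) * f (\<sigma> r)"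
      unfolding w' by (rule congr_mat_diag[OF wc that \<sigma>(3)[OF that]])
    show ?thesis
    proof (cases "\<exists>r<n. \<sigma> r = r")
      case True
      then have "f r * f (\<sigma> r) = 1"
        using k(2) \<sigma>(2)[of r] \<open>\<delta>\<^sup>2 = 1\<close> by (auto simp: f_def power2_eq_square)
      moreover have "w' $$ (r, \<sigma> r) = (f r * f (\<sigma> r)) * w $$ (r, \<sigma> r)"
        unfolding e by (simp only: mult_ac)
      moreover have "\<epsilon>' = 1"
        using True by (simp add: \<epsilon>'_def)
      ultimately show ?thesis
        using entries[OF that] by simp
    next
      case False
      then have "k = 0" "\<sigma> r \<noteq> r" "\<epsilon>' = \<epsilon>"
        using k(3) that by (auto simp: \<epsilon>'_def)
      then show ?thesis
        unfolding e entries[OF that] by (auto simp: f_def \<epsilon>(2) unit_coeff_def mult_ac simp flip: fls_const_mult_const)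
    qed
  qed
  have "det w' = 1"
    using congr_mat_det[OF b2c S(1)] \<open>det b2 = 1\<close> S(3) by (simp add: w'_def)
  moreover have "w' \<in> carrier_mat n n" "transpose_mat w' = w'"
    unfolding w'_def using congr_mat_carrier[OF b2c S(1)] congr_mat_symmetric[OF b2c S(1,2)] by blast+
  moreover have "\<epsilon>' \<in> {1, -1}" "(\<exists>r<n. \<sigma> r = r) \<longrightarrow> \<epsilon>' = 1"
    using \<epsilon>(1) by (simp_all add: \<epsilon>'_def)
  ultimately have "w' \<in> iSymAPM \<iota> n"
    unfolding iSymAPM_iff[OF i_sq] using supp' entries' by blast
  then show ?thesis
    using b2 w'_def by blast
qed

section \<open>Uniqueness of the representative\<close>

text \<open>The entry at \<open>(r, \<tau> r)\<close> of the identity \<open>w b = c\<^sup>T w'\<close>, where \<open>c\<close> is inverse to \<open>b\<close>; on either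
  side only one summand is nonzero.\<close>

lemma Iwahori_congr_entry:
  fixes w w' :: "'k::field fls mat"
  assumes w: "w \<in> carrier_mat n n" "supported_on n \<sigma> w"
    and w': "w' \<in> carrier_mat n n" "supported_on n \<tau> w'"
    and b: "b \<in> carrier_mat n n" and c: "c \<in> carrier_mat n n" "b * c = 1\<^sub>m n"
    and eq: "w' = congr_mat b w" and r: "r < n"
  shows "w $$ (r, \<sigma> r) * b $$ (\<sigma> r, \<tau> r) = c $$ (r, r) * w' $$ (r, \<tau> r)"
proof -
  note \<sigma> = supported_onD[OF w(2)] and \<tau> = supported_onD[OF w'(2)]
  have "transpose_mat c * w' = transpose_mat (b * c) * (w * b)"
    unfolding eq using b c(1) w(1)
    by (simp add: transpose_mult[of _ n n _ n] assoc_mult_mat[of _ n n _ n _ n] mult_carrier_mat[of _ n n _ n])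
  then have "transpose_mat c * w' = w * b"
    using c b w(1) by simp
  then have *: "(w * b) $$ (r, \<tau> r) = (transpose_mat c * w') $$ (r, \<tau> r)"
    by simp
  have "(w * b) $$ (r, \<tau> r) = (\<Sum>k\<in>{0..<n}. w $$ (r, k) * b $$ (k, \<tau> r))"
    using w b r \<tau>(3)[OF r] by (simp add: scalar_prod_def)
  also have "\<dots> = (\<Sum>k\<in>{0..<n}. if k = \<sigma> r then w $$ (r, \<sigma> r) * b $$ (\<sigma> r, \<tau> r) else 0)"
    using \<sigma>(5)[OF r] by (intro sum.cong) auto
  also have "\<dots> = w $$ (r, \<sigma> r) * b $$ (\<sigma> r, \<tau> r)"
    using \<sigma>(3)[OF r] by simp
  finally have L: "(w * b) $$ (r, \<tau> r) = w $$ (r, \<sigma> r) * b $$ (\<sigma> r, \<tau> r)" .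
  have "(transpose_mat c * w') $$ (r, \<tau> r) = (\<Sum>k\<in>{0..<n}. c $$ (k, r) * w' $$ (k, \<tau> r))"
    using w' c r \<tau>(3)[OF r] by (simp add: scalar_prod_def)
  also have "\<dots> = (\<Sum>k\<in>{0..<n}. if k = r then c $$ (r, r) * w' $$ (r, \<tau> r) else 0)"
  proof (intro sum.cong refl)
    fix k assume "k \<in> {0..<n}"
    moreover have "\<tau> r = \<tau> k \<longleftrightarrow> k = r"
      using \<tau>(2) by metis
    ultimately show "c $$ (k, r) * w' $$ (k, \<tau> r) = (if k = r then c $$ (r, r) * w' $$ (r, \<tau> r) else 0)"
      using \<tau>(5)[of k "\<tau> r"] \<tau>(3)[OF r] by auto
  qed
  also have "\<dots> = c $$ (r, r) * w' $$ (r, \<tau> r)"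
    using r by simp
  finally show ?thesis
    using L * by simp
qed

text \<open>With the roles of \<open>w\<close> and \<open>w'\<close> exchanged, this forces both the exponents and the involutions
  to agree.\<close>

lemma Iwahori_congr_exponent:
  fixes w w' :: "'k::field fls mat"
  assumes w: "w \<in> carrier_mat n n" "supported_on n \<sigma> w"
    and w': "w' \<in> carrier_mat n n" "supported_on n \<tau> w'"
    and b: "b \<in> Iwahori_GL n" and c: "c \<in> Iwahori_GL n" "b * c = 1\<^sub>m n"
    and eq: "w' = congr_mat b w" and r: "r < n"
    and ord: "ord_eq k (w $$ (r, \<sigma> r))" "ord_eq k' (w' $$ (r, \<tau> r))"
  shows "k + (if \<tau> r < \<sigma> r then 1 else 0) \<le> k'"
proof -
  note \<sigma> = supported_onD[OF w(2)] and \<tau> = supported_onD[OF w'(2)]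
  have entry: "w $$ (r, \<sigma> r) * b $$ (\<sigma> r, \<tau> r) = c $$ (r, r) * w' $$ (r, \<tau> r)"
    using Iwahori_congr_entry[OF w w' _ _ c(2) eq r] b c by (simp add: Iwahori_GL_def)
  have "ord_eq 0 (c $$ (r, r))"
    using c(1) r by (simp add: Iwahori_GL_def)
  from ord_eq_mult[OF this ord(2)] have "ord_eq k' (w $$ (r, \<sigma> r) * b $$ (\<sigma> r, \<tau> r))"
    by (simp add: entry)
  moreover have "ord_ge (if \<tau> r < \<sigma> r then 1 else 0) (b $$ (\<sigma> r, \<tau> r))"
    using b \<sigma>(3)[OF r] \<tau>(3)[OF r] unfolding Iwahori_GL_def by blast
  with ord(1) have "ord_ge (k + (if \<tau> r < \<sigma> r then 1 else 0)) (w $$ (r, \<sigma> r) * b $$ (\<sigma> r, \<tau> r))"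
    unfolding ord_eq_def by (intro ord_ge_mult) auto
  ultimately show ?thesis
    unfolding ord_eq_def ord_ge_def by (metis not_le)
qed

lemma iSymAPM_unique:
  fixes w w' :: "'k::field fls mat"
  assumes i_sq: "\<iota>\<^sup>2 = -1" and w: "w \<in> iSymAPM \<iota> n" and w': "w' \<in> iSymAPM \<iota> n"
    and b: "b \<in> Iwahori n" and eq: "w' = congr_mat b w"
  shows "w' = w"
proof -
  have i0: "\<iota> \<noteq> 0"
    using i_sq by auto
  obtain \<sigma> \<epsilon> a where \<sigma>: "supported_on n \<sigma> w" and \<epsilon>: "\<epsilon> \<in> {1, -1}" "(\<exists>r<n. \<sigma> r = r) \<longrightarrow> \<epsilon> = 1"
    and a: "\<And>r. r < n \<Longrightarrow> w $$ (r, \<sigma> r) = fls_const (unit_coeff \<iota> \<sigma> \<epsilon> r) * fls_X_intpow (a r)"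
    and wc: "w \<in> carrier_mat n n"
    using w unfolding iSymAPM_iff[OF i_sq] by blast
  obtain \<tau> \<epsilon>' a' where \<tau>: "supported_on n \<tau> w'" and \<epsilon>': "\<epsilon>' \<in> {1, -1}" "(\<exists>r<n. \<tau> r = r) \<longrightarrow> \<epsilon>' = 1"
    and a': "\<And>r. r < n \<Longrightarrow> w' $$ (r, \<tau> r) = fls_const (unit_coeff \<iota> \<tau> \<epsilon>' r) * fls_X_intpow (a' r)"
    and wc': "w' \<in> carrier_mat n n"
    using w' unfolding iSymAPM_iff[OF i_sq] by blast
  have unit: "unit_coeff \<iota> \<sigma>' \<epsilon>'' r \<noteq> 0" if "\<epsilon>'' \<in> {1, -1}" for \<sigma>' \<epsilon>'' r
    using that i0 by (auto simp: unit_coeff_def)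
  have ord: "ord_eq (a r) (w $$ (r, \<sigma> r))" "ord_eq (a' r) (w' $$ (r, \<tau> r))" if "r < n" for r
    unfolding a[OF that] a'[OF that] using ord_eq_mult[of 0 "fls_const _"] unit[OF \<epsilon>(1)] unit[OF \<epsilon>'(1)] by force+
  obtain c where c: "c \<in> Iwahori n" "b * c = 1\<^sub>m n" "c * b = 1\<^sub>m n"
    "\<forall>i<n. fls_nth (b $$ (i, i)) 0 * fls_nth (c $$ (i, i)) 0 = 1"
    using Iwahori_inverse[OF b] .
  have G: "b \<in> Iwahori_GL n" "c \<in> Iwahori_GL n"
    using b c by (simp_all add: Iwahori_iff)
  have C: "b \<in> carrier_mat n n" "c \<in> carrier_mat n n"
    using G by (simp_all add: Iwahori_GL_def)
  have "congr_mat c w' = w"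
    unfolding eq congr_mat_mult[OF C wc] c(2) using wc by simp
  then have eq': "w = congr_mat c w'"
    by simp
  have "a r + (if \<tau> r < \<sigma> r then 1 else 0) \<le> a' r" "a' r + (if \<sigma> r < \<tau> r then 1 else 0) \<le> a r" if "r < n" for r
    using Iwahori_congr_exponent[OF wc \<sigma> wc' \<tau> G c(2) eq that ord[OF that]]
      Iwahori_congr_exponent[OF wc' \<tau> wc \<sigma> G(2,1) c(3) eq' that ord(2,1)[OF that]] by blast+
  then have aa: "a' r = a r" and st: "\<tau> r = \<sigma> r" if "r < n" for r
    using that by (smt (verit) linorder_neqE_nat)+
  have "\<tau> = \<sigma>"
  proof
    show "\<tau> r = \<sigma> r" for r
      using st[of r] supported_onD(1)[OF \<sigma>] supported_onD(1)[OF \<tau>]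
      by (cases "r < n") (auto simp: permutes_def)
  qed
  note \<tau> = \<tau>[unfolded this] and a' = a'[unfolded this] and \<epsilon>' = \<epsilon>'[unfolded this]
  note perm = supported_onD[OF \<sigma>]
  define d where "d r = fls_nth (b $$ (r, r)) 0" for r
  \<comment> \<open>The constant terms of the diagonal of \<open>b\<close> relate the coefficients, and their product is 1.\<close>
  have coeff: "unit_coeff \<iota> \<sigma> \<epsilon>' r = d r * d (\<sigma> r) * unit_coeff \<iota> \<sigma> \<epsilon> r" if r: "r < n" for r
  proof -
    define e where "e = fls_nth (c $$ (r, r)) 0"
    have nth: "fls_nth (f * (fls_const u * fls_X_intpow k)) k = fls_nth f 0 * u"
      if "ord_ge 0 f" for f :: "'k fls" and u k
      using nth_mult_ord_ge[OF that, of k "fls_const u * fls_X_intpow k"]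
        ord_ge_mult[of 0 "fls_const u" k "fls_X_intpow k"] nth_mult_ord_ge[of 0 "fls_const u" k "fls_X_intpow k"]
      by (simp add: ord_ge_def)
    have "b $$ (\<sigma> r, \<sigma> r) * (fls_const (unit_coeff \<iota> \<sigma> \<epsilon> r) * fls_X_intpow (a r))
        = c $$ (r, r) * (fls_const (unit_coeff \<iota> \<sigma> \<epsilon>' r) * fls_X_intpow (a r))"
      using Iwahori_congr_entry[OF wc \<sigma> wc' \<tau> C c(2) eq r] unfolding a[OF r] a'[OF r] aa[OF r]
      by (simp only: mult_ac)
    moreover have "ord_ge 0 (b $$ (\<sigma> r, \<sigma> r))" "ord_ge 0 (c $$ (r, r))"
      using G r perm(3)[OF r] by (auto simp: Iwahori_GL_def ord_eq_def)
    ultimately have "d (\<sigma> r) * unit_coeff \<iota> \<sigma> \<epsilon> r = e * unit_coeff \<iota> \<sigma> \<epsilon>' r"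
      unfolding d_def e_def by (metis nth)
    then have "d r * d (\<sigma> r) * unit_coeff \<iota> \<sigma> \<epsilon> r = (d r * e) * unit_coeff \<iota> \<sigma> \<epsilon>' r"
      by (simp only: mult.assoc)
    then show ?thesis
      using c(4) r by (simp add: d_def e_def)
  qed
  have "\<epsilon>' = \<epsilon> \<or> n = 0"
  proof (cases "(\<exists>r<n. \<sigma> r = r) \<or> n = 0")
    case True
    then show ?thesis
      using \<epsilon>(2) \<epsilon>'(2) by auto
  next
    case False
    then have n: "0 < n" and nofix: "\<And>r. r < n \<Longrightarrow> \<sigma> r \<noteq> r"
      by auto
    have pair: "d r * d (\<sigma> r) = (if r = 0 then \<epsilon>' * \<epsilon> else 1)" if r: "r < n" "r < \<sigma> r" for r
    proof (cases "r = 0")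
      case True
      then have "\<epsilon>' * \<iota> = d r * d (\<sigma> r) * (\<epsilon> * \<iota>)"
        using coeff[OF r(1)] nofix[OF r(1)] by (simp add: unit_coeff_def)
      then have "\<epsilon>' = d r * d (\<sigma> r) * \<epsilon>"
        using i0 by simp
      then show ?thesis
        using \<epsilon>(1) True by auto
    next
      case False
      then show ?thesis
        using coeff[OF r(1)] nofix[OF r(1)] r i0 by (simp add: unit_coeff_def)
    qed
    have "\<sigma> 0 > 0"
      using nofix[OF n] by simp
    have "1 = fls_nth (det b) 0"
      using b by (simp add: Iwahori_iff)
    also have "\<dots> = (\<Prod>r\<in>{..<n}. d r)"
      unfolding d_def by (rule Iwahori_GL_det(2)[OF G(1)])
    also have "\<dots> = (\<Prod>r\<in>{r \<in> {..<n}. r < \<sigma> r}. d r * d (\<sigma> r))"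
      using perm(2,3) nofix by (intro prod.involution_pairs) auto
    also have "\<dots> = (\<Prod>r\<in>{r \<in> {..<n}. r < \<sigma> r}. if r = 0 then \<epsilon>' * \<epsilon> else 1)"
      using pair by (intro prod.cong) auto
    also have "\<dots> = \<epsilon>' * \<epsilon>"
      using n \<open>\<sigma> 0 > 0\<close> by simp
    finally show ?thesis
      using \<epsilon>(1) \<epsilon>'(1) by auto
  qed
  then have "w' $$ (r, \<sigma> r) = w $$ (r, \<sigma> r)" if "r < n" for r
    using that a a' aa by auto
  then have "w' $$ (r, j) = w $$ (r, j)" if "r < n" "j < n" for r j
    using that perm(5)[of r j] supported_onD(5)[OF \<tau>, of r j] by (cases "j = \<sigma> r") auto
  then show "w' = w"
    using wc wc' by (intro eq_matI) auto
qed

section \<open>Gram matrices\<close>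

text \<open>A matrix that is block diagonal for a partition of the indices into singletons and pairs
  is a Gram matrix if every block is.\<close>

lemma block_Gram:
  fixes S :: "'a::field mat"
  assumes S: "S \<in> carrier_mat n n" "transpose_mat S = S"
    and \<pi>: "\<And>r. r < n \<Longrightarrow> \<pi> r < n \<and> \<pi> (\<pi> r) = r"
    and off: "\<And>r c. r < n \<Longrightarrow> c < n \<Longrightarrow> c \<noteq> r \<Longrightarrow> c \<noteq> \<pi> r \<Longrightarrow> S $$ (r, c) = 0"
    and single: "\<And>r. r < n \<Longrightarrow> \<pi> r = r \<Longrightarrow> \<exists>x. x\<^sup>2 = S $$ (r, r)"
    and pair: "\<And>r. r < n \<Longrightarrow> r < \<pi> r \<Longrightarrow> \<exists>x x' y y'. x\<^sup>2 + x'\<^sup>2 = S $$ (r, r) \<and>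
      y\<^sup>2 + y'\<^sup>2 = S $$ (\<pi> r, \<pi> r) \<and> x * y + x' * y' = S $$ (r, \<pi> r)"
  shows "\<exists>g\<in>carrier_mat n n. transpose_mat g * g = S"
proof -
  have "\<exists>v. \<forall>r<n. \<pi> r = r \<longrightarrow> (v r)\<^sup>2 = S $$ (r, r)"
    using single by metis
  then obtain v where v: "\<And>r. r < n \<Longrightarrow> \<pi> r = r \<Longrightarrow> (v r)\<^sup>2 = S $$ (r, r)"
    by blast
  obtain x x' y y' where xy: "\<And>r. r < n \<Longrightarrow> r < \<pi> r \<Longrightarrow> (x r)\<^sup>2 + (x' r)\<^sup>2 = S $$ (r, r) \<and>
      (y r)\<^sup>2 + (y' r)\<^sup>2 = S $$ (\<pi> r, \<pi> r) \<and> x r * y r + x' r * y' r = S $$ (r, \<pi> r)"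
    using pair by metis
  \<comment> \<open>\<open>p r\<close> and \<open>q r\<close> are the coordinates of the \<open>r\<close>-th vector at \<open>r\<close> and at \<open>\<pi> r\<close>.\<close>
  define p where "p r = (if \<pi> r = r then v r else if r < \<pi> r then x r else y' (\<pi> r))" for r
  define q where "q r = (if \<pi> r = r then 0 else if r < \<pi> r then x' r else y (\<pi> r))" for r
  define g where "g = mat n n (\<lambda>(k, r). if k = r then p r else if k = \<pi> r then q r else 0)"
  have g: "g $$ (k, r) = (if k = r then p r else if k = \<pi> r then q r else 0)" if "k < n" "r < n" for k r
    using that by (simp add: g_def)
  have gc: "g \<in> carrier_mat n n"
    by (simp add: g_def)
  have sum: "(transpose_mat g * g) $$ (r, c) = p r * g $$ (r, c) + q r * g $$ (\<pi> r, c)" if r: "r < n" and c: "c < n" for r c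
  proof -
    have "(transpose_mat g * g) $$ (r, c) = (\<Sum>k\<in>{0..<n}. g $$ (k, r) * g $$ (k, c))"
      using gc r c by (simp add: scalar_prod_def)
    also have "\<dots> = (\<Sum>k\<in>{0..<n}. (if k = r then p r * g $$ (r, c) else 0) + (if k = \<pi> r then q r * g $$ (\<pi> r, c) else 0))"
      using r by (intro sum.cong) (auto simp: g q_def)
    also have "\<dots> = p r * g $$ (r, c) + q r * g $$ (\<pi> r, c)"
      using r \<pi>[OF r] by (simp add: sum.distrib)
    finally show ?thesis .
  qed
  have sym: "S $$ (\<pi> r, r) = S $$ (r, \<pi> r)" if "r < n" for r
    using symmetric_index[OF S(2,1)] \<pi>[OF that] that by blast
  have "(transpose_mat g * g) $$ (r, c) = S $$ (r, c)" if r: "r < n" and c: "c < n" for r c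
  proof -
    note \<pi>r = \<pi>[OF r]
    consider "c \<noteq> r" "c \<noteq> \<pi> r" | "c = r" "\<pi> r = r" | "c = r" "\<pi> r \<noteq> r" | "c = \<pi> r" "\<pi> r \<noteq> r"
      by blast
    then show ?thesis
    proof cases
      case 1
      have "r \<noteq> \<pi> c" "\<pi> r \<noteq> \<pi> c"
        using 1 \<pi>r \<pi>[OF c] by metis+
      then show ?thesis
        using 1 off[OF r c] \<pi>r r c by (simp add: sum g)
    next
      case 2
      then show ?thesis
        using v[OF r] r by (simp add: sum g p_def q_def power2_eq_square)
    next
      case 3
      have "p r * p r + q r * q r = S $$ (r, r)"
        using 3 xy[OF r] xy[of "\<pi> r"] \<pi>r by (cases "r < \<pi> r") (auto simp: p_def q_def power2_eq_square add.commute)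
      then show ?thesis
        using 3 r \<pi>r by (simp add: sum g)
    next
      case 4
      have "p r * q (\<pi> r) + q r * p (\<pi> r) = S $$ (r, \<pi> r)"
        using 4 xy[OF r] xy[of "\<pi> r"] \<pi>r sym[OF r]
        by (cases "r < \<pi> r") (auto simp: p_def q_def mult.commute add.commute)
      then show ?thesis
        using 4 r \<pi>r by (simp add: sum g)
    qed
  qed
  then have "transpose_mat g * g = S"
    using S(1) gc by (intro eq_matI) auto
  then show ?thesis
    using gc by blast
qed

lemma perfect_pairing_exists:
  assumes "finite E" "even (card E)"
  shows "\<exists>\<rho>. \<forall>x\<in>E. \<rho> x \<in> E \<and> \<rho> x \<noteq> x \<and> \<rho> (\<rho> x) = x"
  using assms
proof (induction "card E" arbitrary: E rule: less_induct)
  case less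
  show ?case
  proof (cases "E = {}")
    case False
    then obtain x where x: "x \<in> E"
      by blast
    have "E \<noteq> {x}"
      using less.prems by auto
    then obtain y where y: "y \<in> E" "y \<noteq> x"
      using x by blast
    let ?E = "E - {x} - {y}"
    have card: "card E = Suc (Suc (card ?E))"
      using card.remove[of E x] card.remove[of "E - {x}" y] x y less.prems by auto
    then obtain \<rho> where \<rho>: "\<forall>z\<in>?E. \<rho> z \<in> ?E \<and> \<rho> z \<noteq> z \<and> \<rho> (\<rho> z) = z"
      using less.hyps[of ?E] less.prems by auto
    have "\<forall>z\<in>E. (\<rho>(x := y, y := x)) z \<in> E \<and> (\<rho>(x := y, y := x)) z \<noteq> z \<and>
        (\<rho>(x := y, y := x)) ((\<rho>(x := y, y := x)) z) = z"
    proof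
      fix z assume "z \<in> E"
      then consider "z = x" | "z = y" | "z \<in> ?E" "z \<noteq> x" "z \<noteq> y"
        by blast
      then show "(\<rho>(x := y, y := x)) z \<in> E \<and> (\<rho>(x := y, y := x)) z \<noteq> z \<and>
        (\<rho>(x := y, y := x)) ((\<rho>(x := y, y := x)) z) = z"
        by cases (use x y \<rho> in auto)
    qed
    then show ?thesis
      by blast
  qed simp
qed

text \<open>With \<open>c = 1/2\<close> and \<open>I\<close> a square root of \<open>-1\<close>, every element is a sum of two squares.\<close>

lemma sum_two_squares:
  fixes u c I T :: "'a::comm_ring_1"
  assumes "I * I = -1" "2 * c = 1"
  shows "(u * c * (T + 1))\<^sup>2 + (u * c * I * (T - 1))\<^sup>2 = u\<^sup>2 * T"
proof -
  have "(u * c * (T + 1))\<^sup>2 + (u * c * I * (T - 1))\<^sup>2 = (u * c)\<^sup>2 * ((T + 1)\<^sup>2 + (I * I) * (T - 1)\<^sup>2)"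
    by (simp add: power2_eq_square algebra_simps)
  also have "\<dots> = u\<^sup>2 * T * (2 * c)\<^sup>2"
    unfolding assms(1) by (simp add: power2_eq_square algebra_simps)
  finally show ?thesis
    by (simp add: assms(2))
qed

text \<open>Every normalised monomial matrix is the Gram matrix of a basis of determinant 1.\<close>

lemma iSymAPM_Gram:
  fixes w :: "'k::field fls mat"
  assumes two: "(2::'k) \<noteq> 0" and i_sq: "\<iota>\<^sup>2 = -1" and n: "0 < n" and w: "w \<in> iSymAPM \<iota> n"
  shows "\<exists>g\<in>carrier_mat n n. det g = 1 \<and> transpose_mat g * g = w"
proof -
  obtain \<sigma> \<epsilon> a where supp: "supported_on n \<sigma> w" and \<epsilon>: "\<epsilon> \<in> {1, -1}"
    and a: "\<And>r. r < n \<Longrightarrow> w $$ (r, \<sigma> r) = fls_const (unit_coeff \<iota> \<sigma> \<epsilon> r) * fls_X_intpow (a r)"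
    and wc: "w \<in> carrier_mat n n" "transpose_mat w = w" "det w = 1"
    using w unfolding iSymAPM_iff[OF i_sq] by blast
  note \<sigma> = supported_onD[OF supp]
  have sym: "w $$ (\<sigma> r, r) = w $$ (r, \<sigma> r)" if "r < n" for r
    using symmetric_index[OF wc(2,1)] \<sigma>(3) that by blast
  have a_subdegree: "a r = fls_subdegree (w $$ (r, \<sigma> r))" if "r < n" for r
  proof -
    have "unit_coeff \<iota> \<sigma> \<epsilon> r \<noteq> 0"
      using \<sigma>(4)[OF that] a[OF that] by auto
    then have "ord_eq (0 + a r) (w $$ (r, \<sigma> r))"
      unfolding a[OF that] by (intro ord_eq_mult) simp_all
    then show ?thesis
      by (simp add: ord_eq_iff)
  qed
  have a\<sigma>: "a (\<sigma> r) = a r" if "r < n" for r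
    using sym[OF that] \<sigma>(2,3) that by (simp add: a_subdegree)
  \<comment> \<open>The exponents add up to 0, so the number of odd exponents on the diagonal is even.\<close>
  define E where "E = {r \<in> {0..<n}. \<sigma> r = r \<and> odd (a r)}"
  have "fls_X_intpow (\<Sum>r = 0..<n. a r) = (1 :: 'k fls)"
    using det_unit_coeff[OF wc(1) supp i_sq _ a] wc(3) \<epsilon> by auto
  then have "(\<Sum>r = 0..<n. a r) = 0"
    by (metis fls_shift_0 minus_zero ord_eq_X_intpow)
  moreover have "(\<Sum>r = 0..<n. a r) = (\<Sum>r\<in>{r \<in> {0..<n}. \<sigma> r = r}. a r) + (\<Sum>r\<in>{r \<in> {0..<n}. \<sigma> r \<noteq> r}. a r)"
    by (subst sum.union_disjoint[symmetric]) (auto intro!: sum.cong)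
  moreover have "(\<Sum>r\<in>{r \<in> {0..<n}. \<sigma> r \<noteq> r}. a r)
      = (\<Sum>r\<in>{r \<in> {r \<in> {0..<n}. \<sigma> r \<noteq> r}. r < \<sigma> r}. a r + a (\<sigma> r))"
    using \<sigma>(2,3) by (intro sum.involution_pairs) auto
  moreover have "\<dots> = 2 * (\<Sum>r\<in>{r \<in> {r \<in> {0..<n}. \<sigma> r \<noteq> r}. r < \<sigma> r}. a r)"
    unfolding sum_distrib_left using a\<sigma> by (intro sum.cong) auto
  ultimately have "(\<Sum>r\<in>{r \<in> {0..<n}. \<sigma> r = r}. a r)
      = 2 * - (\<Sum>r\<in>{r \<in> {r \<in> {0..<n}. \<sigma> r \<noteq> r}. r < \<sigma> r}. a r)"
    by linarith
  then have "even (\<Sum>r\<in>{r \<in> {0..<n}. \<sigma> r = r}. a r)"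
    by (simp only: dvd_triv_left)
  then have "even (card {r \<in> {r \<in> {0..<n}. \<sigma> r = r}. odd (a r)})"
    by (subst even_sum_iff[symmetric]) auto
  moreover have "{r \<in> {r \<in> {0..<n}. \<sigma> r = r}. odd (a r)} = E"
    by (auto simp: E_def)
  ultimately obtain \<rho> where \<rho>: "\<forall>r\<in>E. \<rho> r \<in> E \<and> \<rho> r \<noteq> r \<and> \<rho> (\<rho> r) = r"
    using perfect_pairing_exists[of E] by (auto simp: E_def)
  define \<pi> where "\<pi> r = (if r \<in> E then \<rho> r else \<sigma> r)" for r
  define I where "I = fls_const \<iota>"
  have I: "I * I = -1"
    using i_sq by (simp add: I_def power2_eq_square)
  have two': "(2 :: 'k fls) \<noteq> 0"
    using two by (simp flip: fls_const_numeral)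
  have "\<exists>g\<in>carrier_mat n n. transpose_mat g * g = w"
  proof (rule block_Gram[OF wc(1,2), of \<pi>])
    fix r assume r: "r < n"
    show "\<pi> r < n \<and> \<pi> (\<pi> r) = r"
    proof (cases "r \<in> E")
      case True
      then show ?thesis
        using \<rho> by (auto simp: \<pi>_def E_def)
    next
      case False
      then have "\<sigma> r \<notin> E"
        using \<sigma>(2) by (auto simp: E_def)
      then show ?thesis
        using False \<sigma>(2,3) r by (simp add: \<pi>_def)
    qed
  next
    fix r c assume rc: "r < n" "c < n" "c \<noteq> r" "c \<noteq> \<pi> r"
    then have "c \<noteq> \<sigma> r"
      by (auto simp: \<pi>_def E_def split: if_splits)
    then show "w $$ (r, c) = 0"
      using \<sigma>(5) rc by blast
  next
    fix r assume r: "r < n" "\<pi> r = r"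
    then have "r \<notin> E" "\<sigma> r = r"
      using \<rho> by (auto simp: \<pi>_def split: if_splits)
    then have ev: "even (a r)" and wr: "w $$ (r, r) = fls_X_intpow (a r)"
      using r(1) a[OF r(1)] by (auto simp: E_def unit_coeff_def)
    obtain k where "a r = 2 * k"
      using ev by (rule evenE)
    then have "(fls_X_intpow k)\<^sup>2 = w $$ (r, r)"
      by (simp add: wr fls_X_intpow_power)
    then show "\<exists>x. x\<^sup>2 = w $$ (r, r)"
      by (rule exI)
  next
    fix r assume r: "r < n" "r < \<pi> r"
    show "\<exists>x x' y y'. x\<^sup>2 + x'\<^sup>2 = w $$ (r, r) \<and> y\<^sup>2 + y'\<^sup>2 = w $$ (\<pi> r, \<pi> r) \<and>
      x * y + x' * y' = w $$ (r, \<pi> r)"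
    proof (cases "r \<in> E")
      case True
      \<comment> \<open>Up to squares the two entries are \<open>t, t\<close>, and this form is equivalent to \<open>1, 1\<close> since \<open>t\<close> is a
        sum of two squares.\<close>
      have "\<exists>k. w $$ (s, s) = (fls_X_intpow k)\<^sup>2 * fls_X_intpow 1" if "s \<in> E" for s
      proof -
        have ws: "w $$ (s, s) = fls_X_intpow (a s)" and od: "odd (a s)"
          using that a[of s] by (auto simp: E_def unit_coeff_def)
        obtain k where "a s = 2 * k + 1"
          using od by (rule oddE)
        then have "w $$ (s, s) = (fls_X_intpow k)\<^sup>2 * fls_X_intpow 1"
          unfolding ws fls_X_intpow_power fls_X_intpow_add by simp
        then show ?thesis
          by (rule exI)
      qed
      moreover have s: "\<pi> r \<in> E" "\<pi> r \<noteq> r" "\<pi> r < n"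
        using True \<rho> by (auto simp: \<pi>_def E_def)
      moreover have "w $$ (r, \<pi> r) = 0"
        using True s \<sigma>(5)[OF r(1), of "\<pi> r"] by (auto simp: E_def)
      ultimately obtain k l where kl: "w $$ (r, r) = (fls_X_intpow k)\<^sup>2 * fls_X_intpow 1"
        "w $$ (\<pi> r, \<pi> r) = (fls_X_intpow l)\<^sup>2 * fls_X_intpow 1" "w $$ (r, \<pi> r) = 0"
        using True by blast
      define c where "c = inverse (2 :: 'k fls)"
      have c: "2 * c = 1"
        using two' by (simp add: c_def)
      define T where "T = (fls_X_intpow 1 :: 'k fls)"
      define x x' where "x = fls_X_intpow k * c * (T + 1)" and "x' = fls_X_intpow k * c * I * (T - 1)"
      define y y' where "y = fls_X_intpow l * c * I * (T - 1)" and "y' = - (fls_X_intpow l * c * (T + 1))"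
      have "x\<^sup>2 + x'\<^sup>2 = w $$ (r, r)"
        unfolding x_def x'_def kl T_def[symmetric] by (rule sum_two_squares[OF I c])
      moreover have "y\<^sup>2 + y'\<^sup>2 = w $$ (\<pi> r, \<pi> r)"
        unfolding y_def y'_def kl T_def[symmetric] power2_minus
        by (subst add.commute) (rule sum_two_squares[OF I c])
      moreover have "x * y + x' * y' = w $$ (r, \<pi> r)"
        by (simp add: kl x_def x'_def y_def y'_def)
      ultimately show ?thesis
        by blast
    next
      case False
      then have \<pi>: "\<pi> r = \<sigma> r"
        by (simp add: \<pi>_def)
      then have "w $$ (r, r) = 0" "w $$ (\<sigma> r, \<sigma> r) = 0"
        using \<sigma>(5)[OF r(1), of r] \<sigma>(5)[OF \<sigma>(3)[OF r(1)], of "\<sigma> r"] \<sigma>(2,3) r by auto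
      moreover define q where "q = w $$ (r, \<sigma> r)"
      have "1\<^sup>2 + I\<^sup>2 = 0" "(q / 2)\<^sup>2 + (- I * q / 2)\<^sup>2 = 0" "1 * (q / 2) + I * (- I * q / 2) = q"
      proof -
        show "1\<^sup>2 + I\<^sup>2 = 0"
          using I by (simp add: power2_eq_square)
        have "(q / 2)\<^sup>2 + (- I * q / 2)\<^sup>2 = (1 + I * I) * (q / 2)\<^sup>2"
          by (simp add: power2_eq_square algebra_simps)
        then show "(q / 2)\<^sup>2 + (- I * q / 2)\<^sup>2 = 0"
          by (simp add: I)
        have "1 * (q / 2) + I * (- I * q / 2) = (1 - I * I) * q / 2"
          by (simp add: algebra_simps diff_divide_distrib)
        then show "1 * (q / 2) + I * (- I * q / 2) = q"
          using two' by (simp add: I)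
      qed
      ultimately show ?thesis
        unfolding \<pi> q_def[symmetric] by metis
    qed
  qed
  then obtain g where g: "g \<in> carrier_mat n n" "transpose_mat g * g = w"
    by blast
  have "(det g)\<^sup>2 = 1"
    using det_mult[of "transpose_mat g" n g] det_transpose[OF g(1)] g wc(3) by (simp add: power2_eq_square)
  then have "det g = 1 \<or> det g = -1"
    by (simp add: power2_eq_1_iff)
  then show ?thesis
  proof
    assume neg: "det g = -1"
    \<comment> \<open>Reflecting the first coordinate changes the sign of the determinant only.\<close>
    define h where "h = mat_diag n (\<lambda>i. if i = 0 then -1 else 1 :: 'k fls)"
    have "(\<lambda>i. (if i = 0 then -1 else 1) * (if i = 0 then -1 else 1)) = (\<lambda>i::nat. 1 :: 'k fls)"
      by auto
    then have "h * h = 1\<^sub>m n"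
      by (simp add: h_def)
    then have h: "h \<in> carrier_mat n n" "transpose_mat h = h" "h * h = 1\<^sub>m n"
      by (auto simp: h_def mat_diag_def)
    have "det h = (\<Prod>r<n. if r = 0 then -1 else 1)"
      unfolding h_def by (subst det_upper_triangular[of _ n])
        (auto simp: mat_diag_def prod_list_diag_prod atLeast0LessThan)
    also have "\<dots> = -1"
      using n by simp
    finally have "det (h * g) = 1"
      using det_mult[OF h(1) g(1)] neg by simp
    moreover have "transpose_mat (h * g) * (h * g) = transpose_mat g * (transpose_mat h * h) * g"
      using g(1) h(1) by (simp add: transpose_mult[of _ n n _ n] assoc_mult_mat[of _ n n _ n _ n] mult_carrier_mat[of _ n n _ n])
    moreover have "h * g \<in> carrier_mat n n"
      using h(1) g(1) by simp
    ultimately show ?thesis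
      using h g by auto
  qed (use g in blast)
qed

section \<open>Double cosets\<close>

lemma double_coset_SL:
  "double_coset (SL n) K g B = {k * g * b |k b. k \<in> K \<and> b \<in> B}"
  unfolding double_coset_def r_coset_def set_mult_def by (auto simp: SL_def)

lemma two_neq_0:
  assumes "CHAR('k::field) \<noteq> 2"
  shows "(2::'k) \<noteq> 0"
proof
  assume "(2::'k) = 0"
  then have "CHAR('k) dvd 2"
    using of_nat_eq_0_iff_char_dvd[of 2, where 'a = 'k] by simp
  then have "CHAR('k) \<le> 2" "CHAR('k) \<noteq> 0"
    by (auto dest: dvd_imp_le intro: ccontr)
  then show False
    using assms CHAR_not_1[where 'a = 'k] by linarith
qed

theorem theorem1p6:
  fixes n :: nat and \<iota> :: "'k::field"
    and G :: "'k fls mat monoid" and K B :: "'k fls mat set"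
  assumes n_pos: "0 < n"
    and char_ne_2: "CHAR('k) \<noteq> 2"
    and sqrt_exists: "\<forall>x::'k. \<exists>y. y\<^sup>2 = x"
    and i_sq: "\<iota>\<^sup>2 = -1"
  defines "G \<equiv> SL n" and "K \<equiv> SO n" and "B \<equiv> Iwahori n"
  shows "(\<forall>O\<^sub>0 \<in> double_cosets G K B.
            \<exists>!w. w \<in> iSymAPM \<iota> n \<and> (\<exists>g\<in>O\<^sub>0. transpose_mat g * g = w)) \<and>
         (\<forall>w \<in> iSymAPM \<iota> n.
            {g \<in> carrier G. transpose_mat g * g = w} \<noteq> {} \<and>
            (\<exists>O\<^sub>0 \<in> double_cosets G K B. {g \<in> carrier G. transpose_mat g * g = w} \<subseteq> O\<^sub>0))"
proof (intro conjI ballI)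
  have two: "(2::'k) \<noteq> 0"
    using char_ne_2 by (rule two_neq_0)
  have Bc: "b \<in> carrier_mat n n" if "b \<in> B" for b
    using that by (simp add: B_def Iwahori_iff Iwahori_GL_def)
  have Gc: "g \<in> carrier G \<longleftrightarrow> g \<in> carrier_mat n n \<and> det g = 1" for g
    by (simp add: G_def SL_def)
  have Kc: "k \<in> K \<longleftrightarrow> k \<in> carrier_mat n n \<and> det k = 1 \<and> transpose_mat k * k = 1\<^sub>m n" for k
    by (auto simp: K_def SO_def SL_def)
  have one: "1\<^sub>m n \<in> K" "1\<^sub>m n \<in> B"
    using one_Iwahori_GL[of n] by (auto simp: Kc B_def Iwahori_iff)
  have gram: "transpose_mat (k * g * b) * (k * g * b) = congr_mat b (transpose_mat g * g)"
    if "k \<in> K" "g \<in> carrier_mat n n" "b \<in> B" for k g b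
  proof -
    have k: "k \<in> carrier_mat n n" "transpose_mat k * k = 1\<^sub>m n"
      using that(1) by (simp_all add: Kc)
    have b: "b \<in> carrier_mat n n"
      using Bc that(3) .
    have "transpose_mat (k * g * b) * (k * g * b) = transpose_mat b * (transpose_mat g * (transpose_mat k * k) * g) * b"
      using k(1) b that(2)
      by (simp add: transpose_mult[of _ n n _ n] assoc_mult_mat[of _ n n _ n _ n] mult_carrier_mat[of _ n n _ n])
    then show ?thesis
      using k(2) that(2) by simp
  qed
  {
    fix O\<^sub>0 assume "O\<^sub>0 \<in> double_cosets G K B"
    then obtain g where g: "g \<in> carrier_mat n n" "det g = 1" and O: "O\<^sub>0 = {k * g * b |k b. k \<in> K \<and> b \<in> B}"
      unfolding double_cosets_def G_def double_coset_SL by (auto simp: SL_def)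
    define S where "S = transpose_mat g * g"
    have S: "S \<in> carrier_mat n n" "transpose_mat S = S" "det S = 1"
      using g by (auto simp: S_def transpose_mult[of _ n n _ n] det_mult[of _ n] det_transpose)
    have forms: "(\<exists>g\<in>O\<^sub>0. transpose_mat g * g = w) \<longleftrightarrow> (\<exists>b\<in>B. w = congr_mat b S)" for w
    proof
      assume "\<exists>g\<in>O\<^sub>0. transpose_mat g * g = w"
      then obtain k b where "k \<in> K" "b \<in> B" "transpose_mat (k * g * b) * (k * g * b) = w"
        unfolding O by blast
      then show "\<exists>b\<in>B. w = congr_mat b S"
        using gram[OF _ g(1)] unfolding S_def by metis
    next
      assume "\<exists>b\<in>B. w = congr_mat b S"
      then obtain b where b: "b \<in> B" "w = congr_mat b S"
        by blast
      then have "transpose_mat (1\<^sub>m n * g * b) * (1\<^sub>m n * g * b) = w"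
        using gram[OF one(1) g(1)] unfolding S_def by metis
      moreover have "1\<^sub>m n * g * b \<in> O\<^sub>0"
        unfolding O using one b by blast
      ultimately show "\<exists>g\<in>O\<^sub>0. transpose_mat g * g = w"
        by blast
    qed
    show "\<exists>!w. w \<in> iSymAPM \<iota> n \<and> (\<exists>g\<in>O\<^sub>0. transpose_mat g * g = w)"
      unfolding forms
    proof (rule ex_ex1I)
      show "\<exists>w. w \<in> iSymAPM \<iota> n \<and> (\<exists>b\<in>B. w = congr_mat b S)"
        using iSymAPM_representative[OF two sqrt_exists i_sq n_pos S] unfolding B_def by blast
    next
      fix w w' assume w: "w \<in> iSymAPM \<iota> n \<and> (\<exists>b\<in>B. w = congr_mat b S)"
        and w': "w' \<in> iSymAPM \<iota> n \<and> (\<exists>b\<in>B. w' = congr_mat b S)"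
      obtain b b' where b: "b \<in> B" "w = congr_mat b S" and b': "b' \<in> B" "w' = congr_mat b' S"
        using w w' by blast
      obtain c where c: "c \<in> B" "b * c = 1\<^sub>m n"
        using Iwahori_inverse b(1) unfolding B_def by blast
      have C: "b \<in> carrier_mat n n" "c \<in> carrier_mat n n" "b' \<in> carrier_mat n n"
        using Bc b b' c by blast+
      have "b * (c * b') = b'"
        using C c(2) by (simp add: assoc_mult_mat[of _ n n _ n _ n, symmetric])
      then have "w' = congr_mat (c * b') w"
        unfolding b(2) b'(2) using congr_mat_mult[OF C(1) _ S(1), of "c * b'"] C by simp
      moreover have "c * b' \<in> Iwahori n"
        using c(1) b'(1) C det_mult[OF C(2,3)] unfolding B_def Iwahori_iff by (simp add: Iwahori_GL_mult)
      ultimately show "w = w'"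
        using iSymAPM_unique[OF i_sq] w w' by metis
    qed
  next
    fix w assume "w \<in> iSymAPM \<iota> n"
    from iSymAPM_Gram[OF two i_sq n_pos this]
    show "{g \<in> carrier G. transpose_mat g * g = w} \<noteq> {}"
      by (auto simp: Gc)
  next
    fix w assume "w \<in> iSymAPM \<iota> n"
    from iSymAPM_Gram[OF two i_sq n_pos this]
    obtain g where g: "g \<in> carrier_mat n n" "det g = 1" "transpose_mat g * g = w"
      by blast
    obtain h where h: "h \<in> carrier_mat n n" "det h = 1" "g * h = 1\<^sub>m n" "h * g = 1\<^sub>m n"
      using SL_inverse[OF g(1,2)] .
    have "{g \<in> carrier G. transpose_mat g * g = w} \<subseteq> double_coset G K g B"
    proof
      fix g' assume "g' \<in> {g \<in> carrier G. transpose_mat g * g = w}"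
      then have g': "g' \<in> carrier_mat n n" "det g' = 1" "transpose_mat g' * g' = w"
        by (auto simp: Gc)
      have "transpose_mat (g' * h) * (g' * h) = transpose_mat h * (transpose_mat g' * g') * h"
        using g'(1) h(1) by (simp add: transpose_mult[of _ n n _ n] assoc_mult_mat[of _ n n _ n _ n] mult_carrier_mat[of _ n n _ n])
      also have "\<dots> = transpose_mat (g * h) * (g * h)"
        unfolding g'(3) g(3)[symmetric] using g(1) h(1)
        by (simp add: transpose_mult[of _ n n _ n] assoc_mult_mat[of _ n n _ n _ n] mult_carrier_mat[of _ n n _ n])
      finally have "g' * h \<in> K"
        using g' h det_mult[OF g'(1) h(1)] by (simp add: Kc)
      moreover have "g' * h * g * 1\<^sub>m n = g'"
        using g' g(1) h by (simp add: assoc_mult_mat[of _ n n _ n _ n])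
      ultimately have "g' = g' * h * g * 1\<^sub>m n \<and> g' * h \<in> K \<and> 1\<^sub>m n \<in> B"
        using one(2) by metis
      then show "g' \<in> double_coset G K g B"
        unfolding G_def double_coset_SL by blast
    qed
    then show "\<exists>O\<^sub>0 \<in> double_cosets G K B. {g \<in> carrier G. transpose_mat g * g = w} \<subseteq> O\<^sub>0"
      unfolding double_cosets_def using g by (auto simp: Gc)
  }
qed

end
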